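(* Let $f=f_1+f_2$ on $\mathbb{R}^m$ and $g=g_1+g_2$ on $\mathbb{R}^n$, where $f_1:\mathbb{R}^m\to\mathbb{R}\cup\{+\infty\}$ is proper, closed and convex; $f_2:\mathbb{R}^m\to\mathbb{R}$ is convex with $L_{f_2}$-Lipschitz continuous gradient; $g_1:\mathbb{R}^n\to\mathbb{R}\cup\{+\infty\}$ is proper, closed and $\mu_g$-strongly convex ($\mu_g>0$); $g_2:\mathbb{R}^n\to\mathbb{R}$ is convex with $L_{g_2}$-Lipschitz continuous gradient. Let $A\in\mathbb{R}^{p\times m}$, $B\in\mathbb{R}^{p\times n}$, $b\in\mathbb{R}^p$, let $\mathcal{L}(x,y,\lambda)=f(x)+g(y)+\langle\lambda,Ax+By-b\rangle$, and suppose its set of saddle points $\Omega$ is nonempty. Let $\alpha,\beta,\gamma>0$ and $t_1\ge1$ with $\alpha\le\frac{1}{L_{f_2}}$, $\beta\le\frac{t_1^2}{L_{g_2}}$; put $a=\frac{\beta\mu_g}{1+\beta\gamma\|B\|^2}$, $\hat b=\frac{2at_1}{a+4t_1}$, and $$t_{k+1}=\min\left\{\frac{1+\sqrt{1+4t_k^2}}{2},\ \sqrt{t_k^2+at_k}\right\},\qquad k\ge1.$$ Let $\{(x_k,y_k)\}_{k\ge1}$ be generated by Algorithm 1 (described in the context) with these parameters, and let $(x^*,y^*,\lambda^* )\in\Omega$. Then for all $k\ge1$, $t_k\ge\min\{1,2\hat b\}\frac{k+1}{2}$, and $$\mathcal{L}(x_k,y_k,\lambda^* )-\mathcal{L}(x^*,y^*,\lambda^*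 )\le\frac{4}{\min\{1,4\hat b^2\}}\cdot\frac{\mathcal{E}_1+\frac{\gamma t_2^2}{2}\|B(y_1-y^* )\|^2}{(k+1)^2},$$ $$\|Ax_k+By_k-b\|\le\frac{4}{\min\{1,4\hat b^2\}}\cdot\frac{C_1}{(k+1)^2},$$ $$|f(x_k)+g(y_k)-f(x^* )-g(y^* )|\le\frac{4}{\min\{1,4\hat b^2\}}\cdot\frac{\mathcal{E}_1+\frac{\gamma t_2^2}{2}\|B(y_1-y^* )\|^2+C_1\|\lambda^*\|}{(k+1)^2},$$ where $$\mathcal{E}_1=t_1^2\big(\mathcal{L}(x_1,y_1,\lambda^* )-\mathcal{L}(x^*,y^*,\lambda^* )\big)+\frac{1}{2\alpha}\|x_1-x^*\|^2+\frac{t_2^2}{2\beta}\|y_1-y^*\|^2+\frac{1}{2\gamma}\|\lambda_1-\lambda^*\|^2,$$ $$C_1=3t_1^2\|Ax_1+By_1-b\|+\frac{2\|\lambda_1-\lambda^*\|+2\sqrt{2\gamma\mathcal{E}_1+\gamma^2t_2^2\|B(y_1-y^* )\|^2}}{\gamma}.$$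
   Context: Norms are Euclidean (operator norm for matrices). $dom(F)=\{x: F(x)<+\infty\}$; $F$ is proper if $dom(F)\ne\emptyset$; $F$ is closed if $F(x)\le\liminf_{y\to x}F(y)$ for all $x$ and $dom(F)$ is closed. $1/0$ is read as $+\infty$ in step-size bounds. $\mu_g$-strong convexity of $g_1$ means $g_1(y_2)-g_1(y_1)-\langle\xi,y_2-y_1\rangle\ge\frac{\mu_g}{2}\|y_2-y_1\|^2$ for all $y_1,y_2$ and $\xi\in\partial g_1(y_1)$. A saddle point is a triple $(x^*,y^*,\lambda^* )$ with $\mathcal{L}(x^*,y^*,\lambda)\le\mathcal{L}(x^*,y^*,\lambda^* )\le\mathcal{L}(x,y,\lambda^* )$ for all $(x,y,\lambda)$. Algorithm 1 (for $\min f(x)+g(y)$ s.t. $Ax+By=b$). Initialize $x_1=x_0=u_1\in dom(f)$, $y_1=y_0=v_1\in dom(g)$, $\lambda_1\in\mathbb{R}^p$. For $k=1,2,\dots$: - $(\bar x_k,\bar y_k)=(x_k,y_k)+\frac{t_k-1}{t_{k+1}}[(x_k,y_k)-(x_{k-1},y_{k-1})]$; - $x_{k+1}=\arg\min_x\big(f_1(x)+\langle A^T\lambda_k+\nabla f_2(\bar x_k),x\rangle+\frac{\gamma t_{k+1}^2}{2}\|A(x-x_k)+\frac{1}{t_{k+1}}(Ax_k+Bv_k-b)\|^2+\frac{1}{2\alpha}\|x-\bar x_k\|^2\big)$; - $u_{k+1}=x_{k+1}+(t_{k+1}-1)(x_{k+1}-x_k)$; - $\eta_k=\frac{\beta}{t_{k+1}^2+\beta\mu_g(t_{k+1}-1)}$;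 - $y_{k+1}=\arg\min_y\big(g_1(y)+\langle B^T\lambda_k+\nabla g_2(\bar y_k),y\rangle+\frac{1}{2\eta_k}\|y-\bar y_k+\eta_k\mu_g(t_{k+1}-1)(\bar y_k-y_k)\|^2+\frac{\gamma t_{k+1}^2}{2}\|B(y-y_k)+\frac{1}{t_{k+1}}(Au_{k+1}+By_k-b)\|^2\big)$; - $v_{k+1}=y_{k+1}+(t_{k+1}-1)(y_{k+1}-y_k)$; - $\lambda_{k+1}=\lambda_k+\gamma t_{k+1}(Au_{k+1}+Bv_{k+1}-b)$. *)

theory Defs
  imports "HOL-Analysis.Analysis"
begin

(* Functions with values in R \<union> {+\<infinity>} have type 'a \<Rightarrow> ereal; that they never take the value
   -\<infinity> is a separate hypothesis wherever they are used. *)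

definition edom :: "('a \<Rightarrow> ereal) \<Rightarrow> 'a set" where
  "edom F = {x. F x < \<infinity>}"

definition proper_fun :: "('a \<Rightarrow> ereal) \<Rightarrow> bool" where
  "proper_fun F \<longleftrightarrow> edom F \<noteq> {}"

definition closed_fun :: "('a::topological_space \<Rightarrow> ereal) \<Rightarrow> bool" where
  "closed_fun F \<longleftrightarrow> (\<forall>x. F x \<le> Liminf (at x) F) \<and> closed (edom F)"

(* The endpoint cases u = 0, v = 0 are harmless because 0 * \<infinity> = 0 in ereal. *)
definition convex_fun :: "('a::real_vector \<Rightarrow> ereal) \<Rightarrow> bool" where
  "convex_fun F \<longleftrightarrow>
     (\<forall>x y. \<forall>u\<ge>0. \<forall>v\<ge>0. u + v = 1 \<longrightarrow>
        F (u *\<^sub>R x + v *\<^sub>R y) \<le> ereal u * F x + ereal v * F y)"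

definition subdifferential :: "('a::real_inner \<Rightarrow> ereal) \<Rightarrow> 'a \<Rightarrow> 'a set" where
  "subdifferential F x = {\<xi>. x \<in> edom F \<and> (\<forall>y. F y \<ge> F x + ereal (\<xi> \<bullet> (y - x)))}"

(* Convexity is required explicitly: the subgradient inequality alone is vacuous for functions
   without subgradients, such as the concave function y \<mapsto> - (norm y)^2. *)
definition strongly_convex_fun :: "real \<Rightarrow> ('a::real_inner \<Rightarrow> ereal) \<Rightarrow> bool" where
  "strongly_convex_fun \<mu> F \<longleftrightarrow> convex_fun F \<and>
     (\<forall>y1 y2. \<forall>\<xi>\<in>subdifferential F y1.
        F y2 - F y1 - ereal (\<xi> \<bullet> (y2 - y1)) \<ge> ereal (\<mu> / 2 * (norm (y2 - y1))\<^sup>2))"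

definition lagrangian ::
  "(real^'m \<Rightarrow> ereal) \<Rightarrow> (real^'n \<Rightarrow> ereal) \<Rightarrow> real^'m^'p \<Rightarrow> real^'n^'p \<Rightarrow> real^'p \<Rightarrow>
   real^'m \<Rightarrow> real^'n \<Rightarrow> real^'p \<Rightarrow> ereal" where
  "lagrangian f g A B b x y l = f x + g y + ereal (l \<bullet> (A *v x + B *v y - b))"

definition saddle_points :: "('x \<Rightarrow> 'y \<Rightarrow> 'l \<Rightarrow> ereal) \<Rightarrow> ('x \<times> 'y \<times> 'l) set" where
  "saddle_points L = {(xs, ys, ls). \<forall>x y l. L xs ys l \<le> L xs ys ls \<and> L xs ys ls \<le> L x y ls}"

definition x_objective ::
  "(real^'m \<Rightarrow> ereal) \<Rightarrow> (real^'m \<Rightarrow> real^'m) \<Rightarrow> real^'m^'p \<Rightarrow> real^'n^'p \<Rightarrow> real^'p \<Rightarrow>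
   real \<Rightarrow> real \<Rightarrow> real \<Rightarrow> real^'m \<Rightarrow> real^'m \<Rightarrow> real^'n \<Rightarrow> real^'p \<Rightarrow> real^'m \<Rightarrow> ereal" where
  "x_objective f1 df2 A B b \<alpha> \<gamma> s xk xbar vk l x =
     f1 x + ereal ((transpose A *v l + df2 xbar) \<bullet> x
       + \<gamma> * s\<^sup>2 / 2 * (norm (A *v (x - xk) + (1 / s) *\<^sub>R (A *v xk + B *v vk - b)))\<^sup>2
       + 1 / (2 * \<alpha>) * (norm (x - xbar))\<^sup>2)"

definition y_objective ::
  "(real^'n \<Rightarrow> ereal) \<Rightarrow> (real^'n \<Rightarrow> real^'n) \<Rightarrow> real^'m^'p \<Rightarrow> real^'n^'p \<Rightarrow> real^'p \<Rightarrow>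
   real \<Rightarrow> real \<Rightarrow> real \<Rightarrow> real \<Rightarrow> real^'n \<Rightarrow> real^'n \<Rightarrow> real^'m \<Rightarrow> real^'p \<Rightarrow> real^'n \<Rightarrow> ereal" where
  "y_objective g1 dg2 A B b \<mu> \<eta> \<gamma> s yk ybar u' l y =
     g1 y + ereal ((transpose B *v l + dg2 ybar) \<bullet> y
       + 1 / (2 * \<eta>) * (norm (y - ybar + (\<eta> * \<mu> * (s - 1)) *\<^sub>R (ybar - yk)))\<^sup>2
       + \<gamma> * s\<^sup>2 / 2 * (norm (B *v (y - yk) + (1 / s) *\<^sub>R (A *v u' + B *v yk - b)))\<^sup>2)"

(* The iterates x, y start at index 0; u, v, l and t are meaningful from index 1 on.
   df2 and dg2 stand for the gradients of f2 and g2. *)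
definition algorithm1 ::
  "(real^'m \<Rightarrow> ereal) \<Rightarrow> (real^'m \<Rightarrow> real) \<Rightarrow> (real^'m \<Rightarrow> real^'m) \<Rightarrow>
   (real^'n \<Rightarrow> ereal) \<Rightarrow> (real^'n \<Rightarrow> real) \<Rightarrow> (real^'n \<Rightarrow> real^'n) \<Rightarrow>
   real^'m^'p \<Rightarrow> real^'n^'p \<Rightarrow> real^'p \<Rightarrow> real \<Rightarrow> real \<Rightarrow> real \<Rightarrow> real \<Rightarrow> (nat \<Rightarrow> real) \<Rightarrow>
   (nat \<Rightarrow> real^'m) \<Rightarrow> (nat \<Rightarrow> real^'n) \<Rightarrow> (nat \<Rightarrow> real^'m) \<Rightarrow> (nat \<Rightarrow> real^'n) \<Rightarrow>
   (nat \<Rightarrow> real^'p) \<Rightarrow> bool" where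
  "algorithm1 f1 f2 df2 g1 g2 dg2 A B b \<mu> \<alpha> \<beta> \<gamma> t x y u v l \<longleftrightarrow>
     x 1 = x 0 \<and> u 1 = x 1 \<and> x 1 \<in> edom (\<lambda>z. f1 z + ereal (f2 z)) \<and>
     y 1 = y 0 \<and> v 1 = y 1 \<and> y 1 \<in> edom (\<lambda>z. g1 z + ereal (g2 z)) \<and>
     (\<forall>k\<ge>1.
        let s = t (k + 1);
            xbar = x k + ((t k - 1) / s) *\<^sub>R (x k - x (k - 1));
            ybar = y k + ((t k - 1) / s) *\<^sub>R (y k - y (k - 1));
            \<eta> = \<beta> / (s\<^sup>2 + \<beta> * \<mu> * (s - 1))
        in is_arg_min (x_objective f1 df2 A B b \<alpha> \<gamma> s (x k) xbar (v k) (l k))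
             (\<lambda>_. True) (x (k + 1)) \<and>
           u (k + 1) = x (k + 1) + (s - 1) *\<^sub>R (x (k + 1) - x k) \<and>
           is_arg_min (y_objective g1 dg2 A B b \<mu> \<eta> \<gamma> s (y k) ybar (u (k + 1)) (l k))
             (\<lambda>_. True) (y (k + 1)) \<and>
           v (k + 1) = y (k + 1) + (s - 1) *\<^sub>R (y (k + 1) - y k) \<and>
           l (k + 1) = l k + (\<gamma> * s) *\<^sub>R (A *v u (k + 1) + B *v v (k + 1) - b))"

end

theory Submission
  imports Defs
begin

text \<open>With \<open>H k\<close> the Lagrangian gap at \<open>\<lambda>*\<close>, the energy
  \<open>E k = t\<^sub>k\<^sup>2 H k + |u\<^sub>k - x*|\<^sup>2 / (2 \<alpha>) + t\<^sub>k\<^sub>+\<^sub>1\<^sup>2 |v\<^sub>k - y*|\<^sup>2 / (2 \<beta>) + |\<lambda>\<^sub>k - \<lambda>*|\<^sup>2 / (2 \<gamma>)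
  + \<gamma> t\<^sub>k\<^sub>+\<^sub>1\<^sup>2 |B (v\<^sub>k - y*)|\<^sup>2 / 2\<close> is nonincreasing: strong convexity leaves a spare term
  \<open>\<mu> t\<^sub>k\<^sub>+\<^sub>1 |v\<^sub>k\<^sub>+\<^sub>1 - y*|\<^sup>2 / 2\<close>, which pays for the growth \<open>t\<^sub>k\<^sub>+\<^sub>2\<^sup>2 - t\<^sub>k\<^sub>+\<^sub>1\<^sup>2 \<le> a t\<^sub>k\<^sub>+\<^sub>1\<close> of the weights.
  Hence \<open>H k \<le> E 1 / t\<^sub>k\<^sup>2\<close>, and \<open>t\<^sub>k\<close> grows linearly. The multipliers stay bounded, and their
  increments are \<open>\<gamma>\<close> times weighted differences of the constraint residuals; summing these bounds
  \<open>t\<^sub>k\<^sup>2\<close> times the residual. The objective gap is \<open>H k\<close> minus \<open>\<lambda>*\<close> applied to the residual.\<close>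

subsection \<open>Proximal steps with composite objectives\<close>

text \<open>Restriction to the line through \<open>x\<close> and \<open>z\<close> reduces this to
  the tangent bound for convex functions of one real variable.\<close>

lemma convex_on_gradient_ineq:
  fixes h :: "'a::euclidean_space \<Rightarrow> real"
  assumes "convex_on UNIV h" and "GDERIV h x :> g"
  shows "h z \<ge> h x + g \<bullet> (z - x)"
proof -
  define p where "p = (\<lambda>r::real. h (x + r *\<^sub>R (z - x)))"
  have "convex_on UNIV p"
  proof (rule convex_onI)
    fix t r q :: real
    assume "0 < t" "t < 1"
    have "x + ((1 - t) * r + t * q) *\<^sub>R (z - x)
        = (1 - t) *\<^sub>R (x + r *\<^sub>R (z - x)) + t *\<^sub>R (x + q *\<^sub>R (z - x))"
      by (simp add: algebra_simps)
    then show "p ((1 - t) *\<^sub>R r + t *\<^sub>R q) \<le> (1 - t) * p r + t * p q"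
      using convex_onD[OF assms(1), of t "x + r *\<^sub>R (z - x)" "x + q *\<^sub>R (z - x)"] \<open>0 < t\<close> \<open>t < 1\<close>
      by (simp add: p_def)
  qed simp
  moreover have "(p has_real_derivative g \<bullet> (z - x)) (at 0)"
  proof -
    have "(h has_derivative (\<lambda>d. g \<bullet> d)) (at (x + 0 *\<^sub>R (z - x)))"
      using assms(2) by (simp add: gderiv_def inner_commute)
    moreover have "((\<lambda>r::real. x + r *\<^sub>R (z - x)) has_derivative (\<lambda>r. r *\<^sub>R (z - x))) (at 0)"
      by (auto intro!: derivative_eq_intros)
    ultimately have "(p has_derivative (\<lambda>r. g \<bullet> (r *\<^sub>R (z - x)))) (at 0)"
      unfolding p_def using has_derivative_compose by blast
    then show ?thesis
      by (simp add: has_field_derivative_def mult_commute_abs)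
  qed
  ultimately have "p 1 - p 0 \<ge> (g \<bullet> (z - x)) * (1 - 0)"
    by (intro convex_on_imp_above_tangent[where A = UNIV]) auto
  then show ?thesis
    by (simp add: p_def)
qed

text \<open>Along the segment, \<open>p\<close> is \<open>h\<close> minus the linear and quadratic
  parts of the bound. The Lipschitz estimate makes its derivative nonpositive for
  \<open>r \<ge> 0\<close>, so comparing \<open>p 1\<close> with \<open>p 0\<close> is
  enough.\<close>

lemma lipschitz_gradient_descent:
  fixes h :: "'a::euclidean_space \<Rightarrow> real"
  assumes grad: "\<And>x. GDERIV h x :> dh x" and lip: "M-lipschitz_on UNIV dh"
  shows "h z \<le> h x + dh x \<bullet> (z - x) + M / 2 * (norm (z - x))\<^sup>2"
proof -
  define d where "d = z - x"
  define p where "p = (\<lambda>r::real. h (x + r *\<^sub>R d) - r * (dh x \<bullet> d) - M / 2 * r\<^sup>2 * (norm d)\<^sup>2)"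
  have der: "(p has_real_derivative dh (x + r *\<^sub>R d) \<bullet> d - dh x \<bullet> d - M * r * (norm d)\<^sup>2) (at r)" for r
  proof -
    have "(h has_derivative (\<lambda>e. dh (x + r *\<^sub>R d) \<bullet> e)) (at (x + r *\<^sub>R d))"
      using grad[of "x + r *\<^sub>R d"] by (simp add: gderiv_def inner_commute)
    moreover have "((\<lambda>r::real. x + r *\<^sub>R d) has_derivative (\<lambda>r. r *\<^sub>R d)) (at r)"
      by (auto intro!: derivative_eq_intros)
    ultimately have "((\<lambda>r. h (x + r *\<^sub>R d)) has_derivative (\<lambda>e. dh (x + r *\<^sub>R d) \<bullet> (e *\<^sub>R d))) (at r)"
      using has_derivative_compose by blast
    then have "((\<lambda>r. h (x + r *\<^sub>R d)) has_real_derivative dh (x + r *\<^sub>R d) \<bullet> d) (at r)"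
      by (simp add: has_field_derivative_def mult_commute_abs)
    then show ?thesis
      unfolding p_def by (auto intro!: derivative_eq_intros)
  qed
  have le: "dh (x + r *\<^sub>R d) \<bullet> d - dh x \<bullet> d - M * r * (norm d)\<^sup>2 \<le> 0" if "0 \<le> r" for r
  proof -
    have "dh (x + r *\<^sub>R d) \<bullet> d - dh x \<bullet> d = (dh (x + r *\<^sub>R d) - dh x) \<bullet> d"
      by (simp add: inner_diff_left)
    also have "\<dots> \<le> norm (dh (x + r *\<^sub>R d) - dh x) * norm d"
      by (rule norm_cauchy_schwarz)
    also have "\<dots> \<le> (M * (r * norm d)) * norm d"
      using lipschitz_onD[OF lip, of "x + r *\<^sub>R d" x] that
      by (intro mult_right_mono) (auto simp: dist_norm)
    finally show ?thesis
      by (simp add: power2_eq_square mult_ac)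
  qed
  have "p 1 \<le> p 0"
  proof (rule DERIV_nonpos_imp_nonincreasing[of 0 1 p])
    fix r :: real
    assume "0 \<le> r"
    then show "\<exists>y. (p has_real_derivative y) (at r) \<and> y \<le> 0"
      using der[of r] le[of r] by blast
  qed simp_all
  then show ?thesis
    by (simp add: p_def d_def)
qed

lemma arg_min_in_edom:
  assumes "proper_fun F" and "is_arg_min (\<lambda>x. F x + ereal (q x)) (\<lambda>_. True) z"
  shows "z \<in> edom F"
proof -
  obtain w where "F w < \<infinity>"
    using assms(1) by (auto simp: proper_fun_def edom_def)
  moreover have "F z + ereal (q z) \<le> F w + ereal (q w)"
    using assms(2) by (auto simp: is_arg_min_def not_less)
  ultimately show ?thesis
    by (cases "F z"; cases "F w") (auto simp: edom_def)
qed

lemma real_of_ereal_eq_finite: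
  assumes "F x \<noteq> - \<infinity>" and "x \<in> edom F"
  shows "F x = ereal (real_of_ereal (F x))"
  using assms by (cases "F x") (auto simp: edom_def)

text \<open>Fermat's rule, obtained without a sum rule for subdifferentials: \<open>z\<close> is
  compared with the point at fraction \<open>r\<close> of the segment to \<open>w\<close>; dividing
  by \<open>r\<close> and letting \<open>r\<close> tend to 0 removes the curvature
  \<open>c d\<close> and leaves the slope \<open>p\<close>.\<close>

lemma arg_min_subgradient:
  fixes F :: "'a::real_inner \<Rightarrow> ereal"
  assumes conv: "convex_fun F" and ninf: "\<And>x. F x \<noteq> - \<infinity>" and nonempty: "proper_fun F"
    and min: "is_arg_min (\<lambda>x. F x + ereal (q x)) (\<lambda>_. True) z"
    and quad: "\<And>d r. q (z + r *\<^sub>R d) = q z + r * (p \<bullet> d) + r\<^sup>2 * c d"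
  shows "- p \<in> subdifferential F z"
proof -
  have dom: "z \<in> edom F"
    using arg_min_in_edom[OF nonempty min] .
  obtain Fz where Fz: "F z = ereal Fz"
    using real_of_ereal_eq_finite[of F z] ninf dom by blast
  have "F w \<ge> F z + ereal (- p \<bullet> (w - z))" for w
  proof (cases "w \<in> edom F")
    case False
    then show ?thesis by (simp add: edom_def)
  next
    case True
    then obtain Fw where Fw: "F w = ereal Fw"
      using real_of_ereal_eq_finite[of F w] ninf by blast
    define d where "d = w - z"
    have key: "Fz - Fw \<le> p \<bullet> d + r * c d" if r: "0 < r" "r < 1" for r
    proof -
      have "F z + ereal (q z) \<le> F (z + r *\<^sub>R d) + ereal (q (z + r *\<^sub>R d))"
        using min by (auto simp: is_arg_min_def not_less)
      also have "z + r *\<^sub>R d = (1 - r) *\<^sub>R z + r *\<^sub>R w"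
        by (simp add: d_def algebra_simps)
      also have "F ((1 - r) *\<^sub>R z + r *\<^sub>R w) + ereal (q ((1 - r) *\<^sub>R z + r *\<^sub>R w))
          \<le> ereal ((1 - r) * Fz + r * Fw) + ereal (q ((1 - r) *\<^sub>R z + r *\<^sub>R w))"
        using conv[unfolded convex_fun_def, rule_format, of "1 - r" r z w] r
        by (intro add_right_mono) (simp add: Fz Fw)
      also have "q ((1 - r) *\<^sub>R z + r *\<^sub>R w) = q z + r * (p \<bullet> d) + r\<^sup>2 * c d"
        using quad[of r d] by (simp add: d_def algebra_simps)
      finally have "r * (Fz - Fw) \<le> r * (p \<bullet> d + r * c d)"
        by (simp add: Fz algebra_simps power2_eq_square)
      then show ?thesis
        using r by simp
    qed
    have "((\<lambda>r. p \<bullet> d + r * c d) \<longlongrightarrow> p \<bullet> d + 0 * c d) (at_right 0)"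
      by (intro tendsto_intros)
    moreover have "eventually (\<lambda>r. Fz - Fw \<le> p \<bullet> d + r * c d) (at_right (0::real))"
      unfolding eventually_at_right_field using key by (intro exI[of _ 1]) auto
    ultimately have "Fz - Fw \<le> p \<bullet> d + 0 * c d"
      by (intro tendsto_lowerbound) auto
    then show ?thesis
      by (simp add: Fz Fw d_def)
  qed
  then show ?thesis
    using dom by (simp add: subdifferential_def)
qed

text \<open>The gradient of \<open>h\<close> is taken at a third point \<open>c\<close>, the
  extrapolated point in the algorithm. Convexity bounds \<open>h w\<close> from below and the
  descent bound \<open>h z\<close> from above, both through \<open>c\<close>. The term
  \<open>m\<close> leaves room for strong convexity.\<close>

lemma composite_subgradient_ineq:
  fixes h :: "'a::euclidean_space \<Rightarrow> real"
  assumes conv: "convex_on UNIV h" and grad: "\<And>x. GDERIV h x :> dh x"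
    and lip: "M-lipschitz_on UNIV dh"
    and sub: "Fw - Fz \<ge> - (p + dh c) \<bullet> (w - z) + m"
  shows "Fw + h w \<ge> Fz + h z - p \<bullet> (w - z) + m - M / 2 * (norm (z - c))\<^sup>2"
  using convex_on_gradient_ineq[OF conv grad, of c w] lipschitz_gradient_descent[OF grad lip, of z c] sub
  by (simp add: algebra_simps)

text \<open>Weighting the inequality at \<open>zs\<close> with \<open>s\<close> and the one at \<open>zk\<close> with \<open>s (s - 1)\<close> turns the
  combination of the displacements from \<open>z\<close> into \<open>s (zs - w)\<close>. The strong convexity terms at
  \<open>z\<close> are then absorbed by the three-point identity.\<close>

lemma accelerated_step:
  fixes z zk zs w wk q :: "'a::real_inner"
  assumes s: "s \<ge> 1" and w: "w = z + (s - 1) *\<^sub>R (z - zk)"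
    and \<mu>: "\<mu> \<ge> 0" and M: "M \<le> \<kappa>"
    and ineq: "\<And>e. e \<in> {zs, zk} \<Longrightarrow>
      \<phi> e \<ge> \<phi> z - (q + (\<kappa> / s) *\<^sub>R (w - wk) + \<mu> *\<^sub>R (w - z)) \<bullet> (e - z)
        + \<mu> / 2 * (norm (e - z))\<^sup>2 - M / 2 * (norm ((1 / s) *\<^sub>R (w - wk)))\<^sup>2"
  shows "s\<^sup>2 * (\<phi> z - \<phi> zs) - s * (s - 1) * (\<phi> zk - \<phi> zs)
    \<le> s * (q \<bullet> (zs - w)) + \<kappa> / 2 * ((norm (wk - zs))\<^sup>2 - (norm (w - zs))\<^sup>2)
      - s * \<mu> / 2 * (norm (w - zs))\<^sup>2"
proof -
  define p where "p = q + (\<kappa> / s) *\<^sub>R (w - wk) + \<mu> *\<^sub>R (w - z)"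
  define R where "R = M / 2 * (norm ((1 / s) *\<^sub>R (w - wk)))\<^sup>2"
  have R: "s\<^sup>2 * R \<le> \<kappa> / 2 * (norm (w - wk))\<^sup>2"
  proof -
    have "s\<^sup>2 * R = M / 2 * (norm (w - wk))\<^sup>2"
      using s by (simp add: R_def power_divide)
    then show ?thesis
      using M by (simp add: mult_right_mono)
  qed
  have 1: "s * \<phi> zs \<ge> s * (\<phi> z - p \<bullet> (zs - z) + \<mu> / 2 * (norm (zs - z))\<^sup>2 - R)"
    using ineq[of zs] s by (intro mult_left_mono) (auto simp: p_def R_def)
  \<comment> \<open>The strong convexity gain towards \<open>zk\<close> is dropped; only the one
    towards \<open>zs\<close> is kept.\<close>
  have "\<mu> / 2 * (norm (zk - z))\<^sup>2 \<ge> 0"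
    using \<mu> by simp
  then have "\<phi> zk \<ge> \<phi> z - p \<bullet> (zk - z) - R"
    using ineq[of zk] by (simp add: p_def R_def)
  then have 2: "s * (s - 1) * \<phi> zk \<ge> s * (s - 1) * (\<phi> z - p \<bullet> (zk - z) - R)"
    using s by (intro mult_left_mono) auto
  have inner: "p \<bullet> (zs - w) = p \<bullet> (zs - z) + (s - 1) * (p \<bullet> (zk - z))"
    unfolding w by (simp add: algebra_simps inner_simps)
  have sum: "s * (p \<bullet> (zs - w)) = s * (p \<bullet> (zs - z)) + s * (s - 1) * (p \<bullet> (zk - z))"
    unfolding inner by (simp add: distrib_left)
  have p: "s * (p \<bullet> (zs - w)) = s * (q \<bullet> (zs - w)) + \<kappa> * ((w - wk) \<bullet> (zs - w))
      + s * \<mu> * ((w - z) \<bullet> (zs - w))"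
    using s by (simp add: p_def inner_add_left algebra_simps)
  \<comment> \<open>Three-point identity, used with \<open>e = z\<close> and with
    \<open>e = wk\<close>. In the second case the square \<open>(norm (w - wk))\<^sup>2\<close> pays
    for \<open>R\<close>.\<close>
  have three: "(w - e) \<bullet> (zs - w)
      = ((norm (e - zs))\<^sup>2 - (norm (w - zs))\<^sup>2 - (norm (w - e))\<^sup>2) / 2" for e
    by (simp add: power2_norm_eq_inner inner_simps inner_commute algebra_simps)
  have zk: "s * \<mu> * ((w - z) \<bullet> (zs - w)) \<le> s * \<mu> / 2 * ((norm (z - zs))\<^sup>2 - (norm (w - zs))\<^sup>2)"
    using s \<mu> unfolding three by (simp add: mult_left_mono)
  have "s\<^sup>2 * (\<phi> z - \<phi> zs) - s * (s - 1) * (\<phi> zk - \<phi> zs)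
      = s\<^sup>2 * \<phi> z - s * \<phi> zs - s * (s - 1) * \<phi> zk"
    by (simp add: algebra_simps power2_eq_square)
  also have "\<dots> \<le> s * (p \<bullet> (zs - w)) - s * \<mu> / 2 * (norm (z - zs))\<^sup>2 + s\<^sup>2 * R"
    using 1 2 unfolding sum norm_minus_commute[of zs z]
    by (simp add: algebra_simps power2_eq_square)
  also have "\<dots> \<le> s * (q \<bullet> (zs - w)) + \<kappa> / 2 * ((norm (wk - zs))\<^sup>2 - (norm (w - zs))\<^sup>2)
      - s * \<mu> / 2 * (norm (w - zs))\<^sup>2"
  proof -
    have "\<kappa> * ((w - wk) \<bullet> (zs - w)) = \<kappa> / 2 * ((norm (wk - zs))\<^sup>2 - (norm (w - zs))\<^sup>2)
        - \<kappa> / 2 * (norm (w - wk))\<^sup>2"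
      unfolding three by (simp add: field_simps)
    moreover have "s * \<mu> / 2 * ((norm (z - zs))\<^sup>2 - (norm (w - zs))\<^sup>2)
        = s * \<mu> / 2 * (norm (z - zs))\<^sup>2 - s * \<mu> / 2 * (norm (w - zs))\<^sup>2"
      by (simp only: right_diff_distrib)
    ultimately show ?thesis
      using R zk unfolding p by linarith
  qed
  finally show ?thesis .
qed

section \<open>Quadratic terms composed with a linear map\<close>

lemma norm_add_scaleR_power2:
  fixes x d :: "'a::real_inner"
  shows "(norm (x + r *\<^sub>R d))\<^sup>2 = (norm x)\<^sup>2 + 2 * r * (x \<bullet> d) + r\<^sup>2 * (norm d)\<^sup>2"
  unfolding power2_norm_eq_inner
  by (simp add: inner_simps inner_commute[of d x] power2_eq_square algebra_simps)

lemma inner_transpose_matrix_vector: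
  fixes A :: "real^'n^'m"
  shows "(transpose A *v x) \<bullet> z = x \<bullet> (A *v z)"
  by (simp add: dot_lmul_matrix)

text \<open>Supplies the exact expansion that \<open>arg_min_subgradient\<close> asks for, in the
  form shared by both subproblems: a linear term, a penalty through \<open>A\<close> and a proximal
  term centred at \<open>zbar\<close>.\<close>

lemma quadratic_expansion:
  fixes A :: "real^'n^'p" and h zk zbar :: "real^'n" and e :: "real^'p" and a c :: real
  defines "q \<equiv> \<lambda>z. h \<bullet> z + a * (norm (A *v (z - zk) + e))\<^sup>2 + c * (norm (z - zbar))\<^sup>2"
  shows "q (z + r *\<^sub>R d) = q z
    + r * ((h + (2 * a) *\<^sub>R (transpose A *v (A *v (z - zk) + e)) + (2 * c) *\<^sub>R (z - zbar)) \<bullet> d)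
    + r\<^sup>2 * (a * (norm (A *v d))\<^sup>2 + c * (norm d)\<^sup>2)"
proof -
  have 1: "A *v (z + r *\<^sub>R d - zk) + e = (A *v (z - zk) + e) + r *\<^sub>R (A *v d)"
    by (simp add: matrix_vector_mult_diff_distrib matrix_vector_right_distrib
        matrix_vector_mult_scaleR)
  have 2: "z + r *\<^sub>R d - zbar = (z - zbar) + r *\<^sub>R d"
    by simp
  show ?thesis
    unfolding q_def 1 2 norm_add_scaleR_power2 inner_add_left inner_scaleR_left
      inner_transpose_matrix_vector
    by (simp add: inner_add_right algebra_simps)
qed

subsection \<open>Momentum parameters and weighted residuals\<close>

text \<open>The first branch of the minimum is the positive root of
  \<open>s * (s - 1) = r\<^sup>2\<close>, the second that of
  \<open>s\<^sup>2 = r\<^sup>2 + a * r\<close>, so each branch yields one upper bound. The first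
  exceeds \<open>r\<close> by at least \<open>1 / 2\<close>, the second by at least
  \<open>2 * a * r / (a + 4 * r)\<close>.\<close>

lemma momentum_step_bounds:
  fixes a r s :: real
  assumes r: "r \<ge> 1" and a: "a > 0"
    and s: "s = min ((1 + sqrt (1 + 4 * r\<^sup>2)) / 2) (sqrt (r\<^sup>2 + a * r))"
  shows "s \<ge> r" and "s * (s - 1) \<le> r\<^sup>2" and "s\<^sup>2 \<le> r\<^sup>2 + a * r"
    and "s - r \<ge> min (1 / 2) (2 * a * r / (a + 4 * r))"
proof -
  have s1: "s \<le> (1 + sqrt (1 + 4 * r\<^sup>2)) / 2" and s2: "s \<le> sqrt (r\<^sup>2 + a * r)"
    unfolding s by (rule min.cobounded1, rule min.cobounded2)
  have half: "(1 + sqrt (1 + 4 * r\<^sup>2)) / 2 \<ge> r + 1 / 2"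
    using real_le_rsqrt[of "2 * r" "1 + 4 * r\<^sup>2"] by (simp add: power2_eq_square)
  \<comment> \<open>With \<open>e \<le> a / 2\<close>, the difference
    \<open>(r + e)\<^sup>2 - r\<^sup>2\<close> is at most \<open>e * (4 * r + a) / 2\<close>, and
    \<open>e\<close> is chosen to make this equal to \<open>a * r\<close>.\<close>
  have sq: "sqrt (r\<^sup>2 + a * r) \<ge> r + 2 * a * r / (a + 4 * r)"
  proof (rule real_le_rsqrt)
    define e where "e = 2 * a * r / (a + 4 * r)"
    have e: "0 \<le> e" "e \<le> a / 2" "e * (a + 4 * r) = 2 * a * r"
      using r a by (auto simp: e_def field_simps)
    have "e * e \<le> e * (a / 2)"
      using e by (intro mult_left_mono) auto
    then have "(r + e)\<^sup>2 \<le> r\<^sup>2 + a * r"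
      using e(3) by (simp add: power2_eq_square algebra_simps)
    then show "(r + 2 * a * r / (a + 4 * r))\<^sup>2 \<le> r\<^sup>2 + a * r"
      by (simp add: e_def)
  qed
  have "2 * a * r / (a + 4 * r) \<ge> 0"
    using r a by auto
  with half sq show "s \<ge> r"
    unfolding s by auto
  with r have "s \<ge> 1" by simp
  show "s - r \<ge> min (1 / 2) (2 * a * r / (a + 4 * r))"
    using half sq unfolding s by linarith
  have "(2 * s - 1)\<^sup>2 \<le> (sqrt (1 + 4 * r\<^sup>2))\<^sup>2"
    using s1 \<open>s \<ge> 1\<close> by (intro power_mono) auto
  also have "\<dots> = 1 + 4 * r\<^sup>2"
    by (simp add: add_nonneg_nonneg)
  finally show "s * (s - 1) \<le> r\<^sup>2"
    by (simp add: power2_eq_square algebra_simps)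
  have "s\<^sup>2 \<le> (sqrt (r\<^sup>2 + a * r))\<^sup>2"
    using s2 \<open>s \<ge> 1\<close> by (intro power_mono) auto
  also have "\<dots> = r\<^sup>2 + a * r"
    using r a by simp
  finally show "s\<^sup>2 \<le> r\<^sup>2 + a * r" .
qed

context
  fixes t :: "nat \<Rightarrow> real" and a :: real
  assumes a: "a > 0" and t1: "t 1 \<ge> 1"
    and rec: "\<And>k. k \<ge> 1 \<Longrightarrow>
      t (k + 1) = min ((1 + sqrt (1 + 4 * (t k)\<^sup>2)) / 2) (sqrt ((t k)\<^sup>2 + a * t k))"
begin

lemma momentum_ge_first: "k \<ge> 1 \<Longrightarrow> t k \<ge> t 1"
proof (induction k rule: dec_induct)
  case (step k)
  then show ?case
    using momentum_step_bounds(1)[OF _ a rec[of k]] t1 by simp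
qed simp

text \<open>Every increment is at least \<open>c\<close>, because
  \<open>2 * a * t k / (a + 4 * t k)\<close> grows with \<open>t k\<close>. Since
  \<open>2 * c \<le> 1\<close>, the resulting bound \<open>1 + (k - 1) * c\<close> dominates
  \<open>c * (k + 1)\<close>.\<close>

lemma momentum_linear_growth:
  assumes "k \<ge> 1"
  defines "bh \<equiv> 2 * a * t 1 / (a + 4 * t 1)"
  shows "t k \<ge> min 1 (2 * bh) * ((real k + 1) / 2)"
proof -
  define c where "c = min (1 / 2) bh"
  have "t k \<ge> 1 + (real k - 1) * c"
    using \<open>k \<ge> 1\<close>
  proof (induction k rule: dec_induct)
    case base
    then show ?case using t1 by simp
  next
    case (step k)
    have tk: "t k \<ge> t 1"
      using momentum_ge_first step by simp
    then have "2 * a * t k / (a + 4 * t k) \<ge> bh"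
      using a t1 unfolding bh_def by (simp add: divide_simps) (simp add: algebra_simps)
    then have "t (Suc k) - t k \<ge> c"
      using momentum_step_bounds(4)[OF _ a rec[of k]] t1 tk step(1) by (simp add: c_def)
    then show ?case
      using step by (simp add: algebra_simps)
  qed
  moreover have "min 1 (2 * bh) * ((real k + 1) / 2) = c * (real k + 1)"
    by (auto simp: c_def min_def)
  moreover have "c \<le> 1 / 2"
    by (simp add: c_def)
  ultimately show ?thesis
    by (simp add: algebra_simps)
qed

end

text \<open>The partial sums obey \<open>S (k + 1) = (1 - c) S k + c p\<close> with \<open>norm p \<le> K\<close>, so they stay in
  the ball of radius \<open>K\<close>.\<close>

lemma norm_le_of_weighted_partial_sums:
  fixes z :: "nat \<Rightarrow> 'a::real_normed_vector"
  assumes c: "\<And>j. j \<ge> 1 \<Longrightarrow> 0 \<le> c j \<and> c j \<le> 1"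
    and z1: "norm (z 1) \<le> K"
    and bound: "\<And>k. k \<ge> 1 \<Longrightarrow> norm (z (k + 1) + (\<Sum>j=1..k. c j *\<^sub>R z j)) \<le> K"
    and k: "k \<ge> 1"
  shows "norm (z k) \<le> 2 * K"
proof -
  define S where "S k = (\<Sum>j=1..k. c j *\<^sub>R z j)" for k
  have S: "norm (S k) \<le> K" if "k \<ge> 1" for k
    using that
  proof (induction k rule: dec_induct)
    case base
    have "norm (c 1 *\<^sub>R z 1) \<le> 1 * norm (z 1)"
      using c[of 1] unfolding norm_scaleR by (intro mult_right_mono) auto
    then show ?case
      using z1 by (simp add: S_def)
  next
    case (step k)
    have ck: "0 \<le> c (Suc k)" "c (Suc k) \<le> 1"
      using c[of "Suc k"] by auto
    have "S (Suc k) = (1 - c (Suc k)) *\<^sub>R S k + c (Suc k) *\<^sub>R (z (k + 1) + S k)"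
      by (simp add: S_def algebra_simps)
    also have "norm \<dots> \<le> (1 - c (Suc k)) * norm (S k) + c (Suc k) * norm (z (k + 1) + S k)"
      using ck by (intro norm_triangle_le) simp
    also have "\<dots> \<le> (1 - c (Suc k)) * K + c (Suc k) * K"
      using ck step.IH bound[of k] step(1) by (intro add_mono mult_left_mono) (auto simp: S_def)
    finally show ?case
      by (simp add: algebra_simps)
  qed
  have K: "K \<ge> 0"
    using z1 norm_ge_zero order_trans by blast
  show ?thesis
  proof (cases "k = 1")
    case True
    then show ?thesis using z1 K by simp
  next
    case False
    define j where "j = k - 1"
    have j: "k = j + 1" "j \<ge> 1"
      using k False by (auto simp: j_def)
    \<comment> \<open>Subtracting \<open>S j\<close> from the sum bounded by hypothesis at
      \<open>j = k - 1\<close> isolates \<open>z k\<close>.\<close>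
    have "norm (z k) \<le> norm (z (j + 1) + S j) + norm (S j)"
      using norm_triangle_ineq4[of "z (j + 1) + S j" "S j"] j by simp
    also have "\<dots> \<le> K + K"
      using bound[of j] S[of j] j by (intro add_mono) (auto simp: S_def)
    finally show ?thesis by simp
  qed
qed

text \<open>The weights \<open>(t j)\<^sup>2\<close> and \<open>t (j + 1) * (t (j + 1) - 1)\<close>
  of \<open>w j\<close> need not agree, so the sum telescopes only up to a defect. This defect is
  the fraction \<open>c j\<close>, between 0 and 1, of \<open>z j\<close>, and
  \<open>norm_le_of_weighted_partial_sums\<close> absorbs it.\<close>

lemma weighted_telescoping_bound:
  fixes w :: "nat \<Rightarrow> 'a::real_normed_vector"
  assumes t: "\<And>k. k \<ge> 1 \<Longrightarrow> t k \<ge> 1"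
    and step: "\<And>k. k \<ge> 1 \<Longrightarrow> t (k + 1) * (t (k + 1) - 1) \<le> (t k)\<^sup>2" "\<And>k. k \<ge> 1 \<Longrightarrow> t k \<le> t (k + 1)"
    and bound: "\<And>k. k \<ge> 1 \<Longrightarrow>
      norm (\<Sum>j=1..k. (t (j + 1))\<^sup>2 *\<^sub>R w (j + 1) - (t (j + 1) * (t (j + 1) - 1)) *\<^sub>R w j) \<le> D"
    and D: "D \<ge> 0" and k: "k \<ge> 1"
  shows "(t k)\<^sup>2 * norm (w k) \<le> 2 * ((t 1)\<^sup>2 * norm (w 1) + D)"
proof -
  define z where "z k = (t k)\<^sup>2 *\<^sub>R w k" for k
  define c where "c j = ((t j)\<^sup>2 - t (j + 1) * (t (j + 1) - 1)) / (t j)\<^sup>2" for j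
  define W where
    "W j = (t (j + 1))\<^sup>2 *\<^sub>R w (j + 1) - (t (j + 1) * (t (j + 1) - 1)) *\<^sub>R w j" for j
  have W: "W j = z (j + 1) - z j + c j *\<^sub>R z j" if "j \<ge> 1" for j
  proof -
    have "c j * (t j)\<^sup>2 = (t j)\<^sup>2 - t (j + 1) * (t (j + 1) - 1)"
      using t[OF that] by (simp add: c_def)
    then have "c j *\<^sub>R z j = ((t j)\<^sup>2 - t (j + 1) * (t (j + 1) - 1)) *\<^sub>R w j"
      by (simp add: z_def)
    then show ?thesis
      by (simp add: z_def W_def scaleR_diff_left)
  qed
  have "norm (z k) \<le> 2 * ((t 1)\<^sup>2 * norm (w 1) + D)"
  proof (rule norm_le_of_weighted_partial_sums[OF _ _ _ k])
    show "0 \<le> c j \<and> c j \<le> 1" if "j \<ge> 1" for j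
      using step(1)[OF that] t[OF that] t[of "j + 1"] by (auto simp: c_def divide_simps)
    show "norm (z 1) \<le> (t 1)\<^sup>2 * norm (w 1) + D"
      using D by (simp add: z_def)
  next
    fix k :: nat
    assume k: "k \<ge> 1"
    have "z (k + 1) + (\<Sum>j=1..k. c j *\<^sub>R z j) = z 1 + (\<Sum>j=1..k. W j)"
      using k by (induction k rule: dec_induct) (simp_all add: W algebra_simps)
    also have "norm \<dots> \<le> norm (z 1) + D"
      by (intro norm_triangle_le add_mono bound[OF k, folded W_def]) simp
    finally show "norm (z (k + 1) + (\<Sum>j=1..k. c j *\<^sub>R z j)) \<le> (t 1)\<^sup>2 * norm (w 1) + D"
      by (simp add: z_def)
  qed
  then show ?thesis
    by (simp add: z_def)
qed

subsection \<open>One iteration of the algorithm\<close>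

text \<open>Lets the merely convex \<open>x\<close> block enter \<open>accelerated_prox_step\<close>
  with modulus 0. Finiteness of \<open>F z\<close> is what permits its subtraction in
  \<open>ereal\<close>.\<close>

lemma subdifferential_strong_ineq_zero:
  assumes "F z \<noteq> - \<infinity>" and "F w \<noteq> - \<infinity>" and "\<xi> \<in> subdifferential F z"
  shows "F w - F z - ereal (\<xi> \<bullet> (w - z)) \<ge> ereal (0 / 2 * (norm (w - z))\<^sup>2)"
proof -
  have "z \<in> edom F" and "F w \<ge> F z + ereal (\<xi> \<bullet> (w - z))"
    using assms(3) by (auto simp: subdifferential_def)
  then show ?thesis
    using assms(1,2) by (cases "F z"; cases "F w") (auto simp: edom_def)
qed

text \<open>Shared by both blocks. Optimality makes \<open>- p\<close> a subgradient, and
  \<open>p\<close> has the form that \<open>accelerated_step\<close> consumes, with \<open>m\<close>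
  as the effective multiplier.\<close>

lemma accelerated_prox_step:
  fixes h :: "real^'n \<Rightarrow> real" and A :: "real^'n^'p"
  assumes F: "convex_fun F" "\<And>z. F z \<noteq> - \<infinity>" "proper_fun F"
    and strong: "\<And>y1 y2 \<xi>. \<xi> \<in> subdifferential F y1 \<Longrightarrow>
      F y2 - F y1 - ereal (\<xi> \<bullet> (y2 - y1)) \<ge> ereal (\<mu> / 2 * (norm (y2 - y1))\<^sup>2)"
    and h: "convex_on UNIV h" "\<And>x. GDERIV h x :> dh x" "M-lipschitz_on UNIV dh"
    and s: "s \<ge> 1" and \<mu>: "\<mu> \<ge> 0" and M: "M \<le> \<kappa>"
    and w: "w = z + (s - 1) *\<^sub>R (z - zk)" and zbar: "z - zbar = (1 / s) *\<^sub>R (w - wk)"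
    and arg_min: "is_arg_min (\<lambda>z. F z + ereal (q z)) (\<lambda>_. True) z"
    and quad: "\<And>d r. q (z + r *\<^sub>R d) = q z + r * (p \<bullet> d) + r\<^sup>2 * c d"
    and p: "p = transpose A *v m + dh zbar + (\<kappa> / s) *\<^sub>R (w - wk) + \<mu> *\<^sub>R (w - z)"
    and dom: "zk \<in> edom F" "zs \<in> edom F"
  defines "\<phi> \<equiv> \<lambda>z. real_of_ereal (F z) + h z"
  shows "s\<^sup>2 * (\<phi> z - \<phi> zs) - s * (s - 1) * (\<phi> zk - \<phi> zs)
    \<le> s * (m \<bullet> (A *v (zs - w))) + \<kappa> / 2 * ((norm (wk - zs))\<^sup>2 - (norm (w - zs))\<^sup>2)
      - s * \<mu> / 2 * (norm (w - zs))\<^sup>2"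
proof -
  \<comment> \<open>\<open>p'\<close> is \<open>p\<close> without the gradient of \<open>h\<close>,
    which \<open>composite_subgradient_ineq\<close> adds back.\<close>
  define p' where "p' = transpose A *v m + (\<kappa> / s) *\<^sub>R (w - wk) + \<mu> *\<^sub>R (w - z)"
  have sub: "- p \<in> subdifferential F z"
    by (rule arg_min_subgradient[where q = q, OF F arg_min quad])
  have z: "z \<in> edom F"
    using arg_min_in_edom[OF F(3) arg_min] .
  have "\<phi> e \<ge> \<phi> z - p' \<bullet> (e - z) + \<mu> / 2 * (norm (e - z))\<^sup>2
      - M / 2 * (norm ((1 / s) *\<^sub>R (w - wk)))\<^sup>2" if "e \<in> {zs, zk}" for e
    unfolding \<phi>_def zbar[symmetric]
  proof (rule composite_subgradient_ineq[OF h])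
    have "e \<in> edom F"
      using dom that by auto
    then obtain Fe Fz where "F e = ereal Fe" "F z = ereal Fz"
      using real_of_ereal_eq_finite[of F] F(2) z by metis
    moreover have "p' + dh zbar = p"
      by (simp add: p p'_def)
    ultimately show "real_of_ereal (F e) - real_of_ereal (F z)
        \<ge> - (p' + dh zbar) \<bullet> (e - z) + \<mu> / 2 * (norm (e - z))\<^sup>2"
      using strong[OF sub, of e] by simp
  qed
  from accelerated_step[OF s w \<mu> M this[unfolded p'_def]]
  show ?thesis
    by (simp only: inner_transpose_matrix_vector)
qed

text \<open>Because \<open>u - zk\<close> is \<open>s\<close> times \<open>z - zk\<close>, the
  penalty of a subproblem sees the residual at \<open>u\<close>, scaled by \<open>1 / s\<close>. The
  vector \<open>e\<close> carries the other block and \<open>b\<close>.\<close>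

lemma residual_at_new_point:
  fixes A :: "real^'m^'p"
  assumes "s \<ge> 1" and "u = z + (s - 1) *\<^sub>R (z - zk)"
  shows "A *v (z - zk) + (1 / s) *\<^sub>R (A *v zk + e) = (1 / s) *\<^sub>R (A *v u + e)"
proof -
  have "A *v u = s *\<^sub>R (A *v (z - zk)) + A *v zk"
    unfolding assms(2)
    by (simp add: algebra_simps matrix_vector_mult_diff_distrib matrix_vector_right_distrib
        matrix_vector_mult_scaleR)
  then show ?thesis
    using assms(1) by (simp add: scaleR_add_right)
qed

text \<open>The case \<open>\<mu> = 0\<close>, \<open>\<kappa> = 1 / \<alpha>\<close> of
  \<open>accelerated_prox_step\<close>. The effective multiplier contains the old \<open>vk\<close>
  because \<open>x\<close> is updated before \<open>y\<close>.\<close>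

lemma x_update_ineq:
  fixes f2 :: "real^'m \<Rightarrow> real" and A :: "real^'m^'p" and B :: "real^'n^'p"
  assumes f1: "convex_fun f1" "\<And>z. f1 z \<noteq> - \<infinity>" "proper_fun f1"
    and f2: "convex_on UNIV f2" "\<And>x. GDERIV f2 x :> df2 x" "M-lipschitz_on UNIV df2"
    and s: "s \<ge> 1" and M: "M \<le> 1 / \<alpha>"
    and u: "u = x + (s - 1) *\<^sub>R (x - xk)" and xbar: "x - xbar = (1 / s) *\<^sub>R (u - uk)"
    and arg_min: "is_arg_min (x_objective f1 df2 A B b \<alpha> \<gamma> s xk xbar vk l) (\<lambda>_. True) x"
    and dom: "xk \<in> edom f1" "xs \<in> edom f1"
  defines "\<phi> \<equiv> \<lambda>z. real_of_ereal (f1 z) + f2 z"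
  shows "s\<^sup>2 * (\<phi> x - \<phi> xs) - s * (s - 1) * (\<phi> xk - \<phi> xs)
    \<le> s * ((l + (\<gamma> * s) *\<^sub>R (A *v u + B *v vk - b)) \<bullet> (A *v (xs - u)))
      + 1 / (2 * \<alpha>) * ((norm (uk - xs))\<^sup>2 - (norm (u - xs))\<^sup>2)"
proof -
  define e where "e = (1 / s) *\<^sub>R (A *v xk + B *v vk - b)"
  define h where "h = transpose A *v l + df2 xbar"
  define m where "m = l + (\<gamma> * s) *\<^sub>R (A *v u + B *v vk - b)"
  have res: "A *v (x - xk) + e = (1 / s) *\<^sub>R (A *v u + B *v vk - b)"
    using residual_at_new_point[OF s u, of A "B *v vk - b"] by (simp add: e_def add_diff_eq)
  have am: "is_arg_min (\<lambda>z. f1 z + ereal (h \<bullet> z + \<gamma> * s\<^sup>2 / 2 * (norm (A *v (z - xk) + e))\<^sup>2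
      + 1 / (2 * \<alpha>) * (norm (z - xbar))\<^sup>2)) (\<lambda>_. True) x"
    using arg_min unfolding x_objective_def e_def h_def .
  \<comment> \<open>The penalty weight \<open>\<gamma> * s\<^sup>2\<close> times the factor
    \<open>1 / s\<close> from \<open>res\<close> gives the shift \<open>\<gamma> * s\<close> inside
    \<open>m\<close>.\<close>
  have p: "h + (2 * (\<gamma> * s\<^sup>2 / 2)) *\<^sub>R (transpose A *v (A *v (x - xk) + e))
      + (2 * (1 / (2 * \<alpha>))) *\<^sub>R (x - xbar)
    = transpose A *v m + df2 xbar + (1 / \<alpha> / s) *\<^sub>R (u - uk) + 0 *\<^sub>R (u - x)"
    using s unfolding res xbar h_def m_def
    by (simp add: matrix_vector_right_distrib matrix_vector_mult_scaleR power2_eq_square)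
  have "s\<^sup>2 * (\<phi> x - \<phi> xs) - s * (s - 1) * (\<phi> xk - \<phi> xs)
    \<le> s * (m \<bullet> (A *v (xs - u))) + 1 / \<alpha> / 2 * ((norm (uk - xs))\<^sup>2 - (norm (u - xs))\<^sup>2)
      - s * 0 / 2 * (norm (u - xs))\<^sup>2"
    unfolding \<phi>_def
    by (rule accelerated_prox_step[OF f1 subdifferential_strong_ineq_zero f2 s _ M u xbar am
          quadratic_expansion p dom]) (use f1 in auto)
  then show ?thesis
    by (simp add: m_def mult.commute)
qed

text \<open>The step \<open>\<eta>\<close> and the shift in the proximal term are chosen so that its gradient is
  \<open>(s / \<beta>) (v - vk) + \<mu> (v - y)\<close>, the shape required by \<open>accelerated_prox_step\<close>.\<close>

lemma y_update_ineq:
  fixes g2 :: "real^'n \<Rightarrow> real" and A :: "real^'m^'p" and B :: "real^'n^'p"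
  assumes g1: "convex_fun g1" "\<And>z. g1 z \<noteq> - \<infinity>" "proper_fun g1"
    and strong: "strongly_convex_fun \<mu> g1"
    and g2: "convex_on UNIV g2" "\<And>x. GDERIV g2 x :> dg2 x" "M-lipschitz_on UNIV dg2"
    and s: "s \<ge> 1" and \<mu>: "\<mu> \<ge> 0" and \<beta>: "\<beta> > 0" and M: "M \<le> s\<^sup>2 / \<beta>"
    and v: "v = y + (s - 1) *\<^sub>R (y - yk)" and ybar: "y - ybar = (1 / s) *\<^sub>R (v - vk)"
    and \<eta>: "\<eta> = \<beta> / (s\<^sup>2 + \<beta> * \<mu> * (s - 1))"
    and arg_min: "is_arg_min (y_objective g1 dg2 A B b \<mu> \<eta> \<gamma> s yk ybar u l) (\<lambda>_. True) y"
    and dom: "yk \<in> edom g1" "ys \<in> edom g1"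
  defines "\<phi> \<equiv> \<lambda>z. real_of_ereal (g1 z) + g2 z"
  shows "s\<^sup>2 * (\<phi> y - \<phi> ys) - s * (s - 1) * (\<phi> yk - \<phi> ys)
    \<le> s * ((l + (\<gamma> * s) *\<^sub>R (A *v u + B *v v - b)) \<bullet> (B *v (ys - v)))
      + s\<^sup>2 / (2 * \<beta>) * ((norm (vk - ys))\<^sup>2 - (norm (v - ys))\<^sup>2) - s * \<mu> / 2 * (norm (v - ys))\<^sup>2"
proof -
  define e where "e = (1 / s) *\<^sub>R (A *v u + B *v yk - b)"
  define h where "h = transpose B *v l + dg2 ybar"
  define m where "m = l + (\<gamma> * s) *\<^sub>R (A *v u + B *v v - b)"
  \<comment> \<open>The shift in \<open>y_objective\<close> is absorbed into the proximal centre, so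
    that \<open>quadratic_expansion\<close> applies.\<close>
  define c where "c = ybar - (\<eta> * \<mu> * (s - 1)) *\<^sub>R (ybar - yk)"
  have res: "B *v (y - yk) + e = (1 / s) *\<^sub>R (A *v u + B *v v - b)"
    using residual_at_new_point[OF s v, of B "A *v u - b"] by (simp add: e_def algebra_simps)
  have am: "is_arg_min (\<lambda>z. g1 z + ereal (h \<bullet> z + \<gamma> * s\<^sup>2 / 2 * (norm (B *v (z - yk) + e))\<^sup>2
      + 1 / (2 * \<eta>) * (norm (z - c))\<^sup>2)) (\<lambda>_. True) y"
    using arg_min unfolding y_objective_def e_def h_def c_def by (simp add: algebra_simps)
  have pos: "s\<^sup>2 + \<beta> * \<mu> * (s - 1) > 0"
    using s \<mu> \<beta> by (intro add_pos_nonneg) auto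
  \<comment> \<open>The two weights in \<open>1 / \<eta>\<close> serve different ends:
    \<open>s\<^sup>2 / \<beta>\<close> gives the proximal part of the gradient,
    \<open>\<mu> * (s - 1)\<close> the strongly convex part.\<close>
  have inv: "1 / \<eta> = s\<^sup>2 / \<beta> + \<mu> * (s - 1)"
    using pos \<beta> unfolding \<eta> by (simp add: field_simps)
  have \<eta>0: "\<eta> > 0"
    unfolding \<eta> using pos \<beta> by simp
  \<comment> \<open>The factor \<open>\<eta>\<close> of the shift cancels, and the two displacements
    weighted by \<open>\<mu> * (s - 1)\<close> join across \<open>ybar\<close> to
    \<open>y - yk\<close>.\<close>
  have "(1 / \<eta>) *\<^sub>R (y - c) = (1 / \<eta>) *\<^sub>R (y - ybar) + (\<mu> * (s - 1)) *\<^sub>R (ybar - yk)"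
    using \<eta>0 by (simp add: c_def scaleR_diff_right scaleR_add_right)
  also have "\<dots> = (s\<^sup>2 / \<beta>) *\<^sub>R (y - ybar) + \<mu> *\<^sub>R (s - 1) *\<^sub>R (y - yk)"
    unfolding inv by (simp add: algebra_simps)
  also have "(s - 1) *\<^sub>R (y - yk) = v - y"
    by (simp add: v)
  finally have prox: "(1 / \<eta>) *\<^sub>R (y - c) = (s\<^sup>2 / \<beta>) *\<^sub>R (y - ybar) + \<mu> *\<^sub>R (v - y)" .
  have p: "h + (2 * (\<gamma> * s\<^sup>2 / 2)) *\<^sub>R (transpose B *v (B *v (y - yk) + e))
      + (2 * (1 / (2 * \<eta>))) *\<^sub>R (y - c)
    = transpose B *v m + dg2 ybar + (s\<^sup>2 / \<beta> / s) *\<^sub>R (v - vk) + \<mu> *\<^sub>R (v - y)"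
  proof -
    have "(2 * (1 / (2 * \<eta>))) *\<^sub>R (y - c) = (s\<^sup>2 / \<beta> / s) *\<^sub>R (v - vk) + \<mu> *\<^sub>R (v - y)"
      using prox unfolding ybar by simp
    then show ?thesis
      using s unfolding res h_def m_def
      by (simp add: matrix_vector_right_distrib matrix_vector_mult_scaleR power2_eq_square)
  qed
  have "s\<^sup>2 * (\<phi> y - \<phi> ys) - s * (s - 1) * (\<phi> yk - \<phi> ys)
    \<le> s * (m \<bullet> (B *v (ys - v))) + s\<^sup>2 / \<beta> / 2 * ((norm (vk - ys))\<^sup>2 - (norm (v - ys))\<^sup>2)
      - s * \<mu> / 2 * (norm (v - ys))\<^sup>2"
    unfolding \<phi>_def
    by (rule accelerated_prox_step[OF g1 _ g2 s \<mu> M v ybar am quadratic_expansion p dom])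
      (use strong in \<open>auto simp: strongly_convex_fun_def\<close>)
  then show ?thesis
    by (simp add: m_def mult.commute)
qed

text \<open>Here \<open>r\<close> is the residual at the new point, \<open>d = B (v' - v)\<close> and \<open>e = B (v' - y*)\<close>, so that
  \<open>A (x* - u') = e - r\<close>. The slack is \<open>\<gamma> s\<^sup>2 / 2 * norm (r - d)\<^sup>2\<close>.\<close>

lemma multiplier_step_ineq:
  fixes r d e l l' ls :: "'a::real_inner"
  assumes \<gamma>: "\<gamma> > 0" and l': "l' = l + (\<gamma> * s) *\<^sub>R r"
  shows "s * ((l' - (\<gamma> * s) *\<^sub>R d) \<bullet> (e - r)) - s * (l' \<bullet> e) + s * (ls \<bullet> r)
    \<le> 1 / (2 * \<gamma>) * ((norm (l - ls))\<^sup>2 - (norm (l' - ls))\<^sup>2)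
      + \<gamma> * s\<^sup>2 / 2 * ((norm (e - d))\<^sup>2 - (norm e)\<^sup>2)"
proof -
  define n where "n = l - ls"
  have n: "l = n + ls" "l' = n + ls + (\<gamma> * s) *\<^sub>R r"
    by (simp_all add: n_def l')
  have "(norm (l - ls))\<^sup>2 - (norm (l' - ls))\<^sup>2 = - (2 * \<gamma> * s * (n \<bullet> r)) - (\<gamma> * s)\<^sup>2 * (norm r)\<^sup>2"
    using norm_add_scaleR_power2[of n "\<gamma> * s" r] by (simp add: n algebra_simps)
  then have 1: "1 / (2 * \<gamma>) * ((norm (l - ls))\<^sup>2 - (norm (l' - ls))\<^sup>2)
      = - (s * (n \<bullet> r)) - \<gamma> * s\<^sup>2 / 2 * (norm r)\<^sup>2"
    using \<gamma> by (simp add: field_simps power2_eq_square)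
  have 2: "(norm (e - d))\<^sup>2 - (norm e)\<^sup>2 = (norm d)\<^sup>2 - 2 * (e \<bullet> d)"
    unfolding power2_norm_eq_inner by (simp add: inner_simps inner_commute[of d e])
  have 3: "s * ((l' - (\<gamma> * s) *\<^sub>R d) \<bullet> (e - r)) - s * (l' \<bullet> e) + s * (ls \<bullet> r)
      = - (s * (n \<bullet> r)) - \<gamma> * s\<^sup>2 * (norm r)\<^sup>2 - \<gamma> * s\<^sup>2 * (e \<bullet> d) + \<gamma> * s\<^sup>2 * (r \<bullet> d)"
    unfolding n power2_norm_eq_inner
    by (simp add: inner_simps inner_commute[of d] power2_eq_square algebra_simps)
  have "\<gamma> * s\<^sup>2 / 2 * (norm (r - d))\<^sup>2 \<ge> 0"
    using \<gamma> by simp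
  moreover have "(norm (r - d))\<^sup>2 = (norm r)\<^sup>2 + (norm d)\<^sup>2 - 2 * (r \<bullet> d)"
    unfolding power2_norm_eq_inner by (simp add: inner_simps inner_commute[of d r])
  ultimately show ?thesis
    unfolding 1 2 3 by (simp add: algebra_simps)
qed

text \<open>The scalar part of the energy argument: \<open>U\<close>, \<open>V\<close>,
  \<open>Z\<close>, \<open>W\<close> stand for the squared distances of \<open>u\<close>,
  \<open>v\<close>, the multiplier and the image of \<open>v\<close> under \<open>B\<close>; primes
  mark the next iterate.\<close>

lemma energy_decrease:
  fixes s s' r :: real
  assumes pos: "\<beta> > 0" "\<gamma> > 0" "s \<ge> 0"
    and step: "s\<^sup>2 * H' - s * (s - 1) * H
      \<le> 1 / (2 * \<alpha>) * (U - U') + s\<^sup>2 / (2 * \<beta>) * (V - V') - s * \<mu> / 2 * V'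
        + 1 / (2 * \<gamma>) * (Z - Z') + \<gamma> * s\<^sup>2 / 2 * (W - W')"
    and nonneg: "H \<ge> 0" "V' \<ge> 0" "W' \<ge> 0" and W: "W' \<le> N\<^sup>2 * V'"
    and s: "s * (s - 1) \<le> r\<^sup>2" "s'\<^sup>2 \<le> s\<^sup>2 + a * s"
    and a: "a = \<beta> * \<mu> / (1 + \<beta> * \<gamma> * N\<^sup>2)" "a \<ge> 0"
  shows "s\<^sup>2 * H' + 1 / (2 * \<alpha>) * U' + s'\<^sup>2 / (2 * \<beta>) * V' + 1 / (2 * \<gamma>) * Z' + \<gamma> * s'\<^sup>2 / 2 * W'
    \<le> r\<^sup>2 * H + 1 / (2 * \<alpha>) * U + s\<^sup>2 / (2 * \<beta>) * V + 1 / (2 * \<gamma>) * Z + \<gamma> * s\<^sup>2 / 2 * W"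
proof -
  \<comment> \<open>\<open>Q\<close> is the common factor of the two terms weighted by
    \<open>s'\<^sup>2\<close>.\<close>
  define Q where "Q = V' / (2 * \<beta>) + \<gamma> / 2 * W'"
  have "s'\<^sup>2 * Q \<le> (s\<^sup>2 + a * s) * Q"
    using s(2) pos nonneg by (intro mult_right_mono) (auto simp: Q_def)
  also have "\<dots> = s\<^sup>2 * Q + s * (a * Q)"
    by (simp add: algebra_simps)
  \<comment> \<open>The constant \<open>a\<close> is calibrated for this:
    \<open>W' \<le> N\<^sup>2 * V'\<close> bounds \<open>Q\<close> by a multiple of
    \<open>V'\<close>, and \<open>a\<close> turns the multiple into
    \<open>\<mu> / 2\<close>.\<close>
  also have "a * Q \<le> \<mu> / 2 * V'"
  proof -
    have "Q \<le> V' / (2 * \<beta>) + \<gamma> / 2 * (N\<^sup>2 * V')"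
      using W pos by (simp add: Q_def)
    also have "\<dots> = (1 + \<beta> * \<gamma> * N\<^sup>2) * V' / (2 * \<beta>)"
      using pos by (simp add: field_simps)
    finally have "a * Q \<le> a * ((1 + \<beta> * \<gamma> * N\<^sup>2) * V' / (2 * \<beta>))"
      using a(2) by (rule mult_left_mono)
    moreover have "a * (1 + \<beta> * \<gamma> * N\<^sup>2) = \<beta> * \<mu>"
      using pos add_pos_nonneg[of 1 "\<beta> * \<gamma> * N\<^sup>2"] by (simp add: a(1))
    then have "a * ((1 + \<beta> * \<gamma> * N\<^sup>2) * V' / (2 * \<beta>)) = \<mu> / 2 * V'"
      using pos by (simp add: mult.assoc[symmetric])
    ultimately show ?thesis by (rule ord_le_eq_trans)
  qed
  finally have Q: "s'\<^sup>2 * Q \<le> s\<^sup>2 * Q + s * (\<mu> / 2 * V')"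
    using pos(3) by (simp add: mult_left_mono)
  have Q_eq: "c\<^sup>2 * Q = c\<^sup>2 / (2 * \<beta>) * V' + \<gamma> * c\<^sup>2 / 2 * W'" for c
    by (simp add: Q_def algebra_simps)
  have "s * (s - 1) * H \<le> r\<^sup>2 * H"
    using s(1) nonneg(1) by (rule mult_right_mono)
  moreover have "s * \<mu> / 2 * V' = s * (\<mu> / 2 * V')"
    by simp
  ultimately show ?thesis
    using Q[unfolded Q_eq] step[unfolded right_diff_distrib[of _ U] right_diff_distrib[of _ V]
        right_diff_distrib[of _ Z] right_diff_distrib[of _ W]]
    by linarith
qed

text \<open>Comparison with a point of finite value forces finiteness. Moving the multiplier by the
  residual \<open>?r\<close> raises the Lagrangian by \<open>?r \<bullet> ?r\<close>, which the
  other saddle inequality forbids unless \<open>?r = 0\<close>.\<close>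

lemma saddle_point_finite_feasible:
  assumes saddle: "(xs, ys, ls) \<in> saddle_points (lagrangian f g A B b)"
    and ninf: "\<And>x. f x \<noteq> - \<infinity>" "\<And>y. g y \<noteq> - \<infinity>" and proper: "proper_fun f" "proper_fun g"
  shows "xs \<in> edom f" and "ys \<in> edom g" and "A *v xs + B *v ys = b"
proof -
  obtain x y where xy: "f x < \<infinity>" "g y < \<infinity>"
    using proper by (auto simp: proper_fun_def edom_def)
  let ?r = "A *v xs + B *v ys - b"
  have 1: "lagrangian f g A B b xs ys (ls + ?r) \<le> lagrangian f g A B b xs ys ls"
    and 2: "lagrangian f g A B b xs ys ls \<le> lagrangian f g A B b x y ls"
    using saddle unfolding saddle_points_def by blast+
  from 2 xy ninf have fin: "f xs < \<infinity>" "g ys < \<infinity>"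
    using ninf(1)[of x] ninf(1)[of xs] ninf(2)[of y] ninf(2)[of ys]
    by (cases "f x"; cases "g y"; cases "f xs"; cases "g ys"; simp add: lagrangian_def)+
  then show "xs \<in> edom f" "ys \<in> edom g"
    by (auto simp: edom_def)
  from 1 fin have "(ls + ?r) \<bullet> ?r \<le> ls \<bullet> ?r"
    using ninf(1)[of xs] ninf(2)[of ys]
    by (cases "f xs"; cases "g ys"; simp add: lagrangian_def)
  then have "?r \<bullet> ?r \<le> 0"
    by (simp add: inner_add_left)
  then have "?r = 0"
    by (metis inner_eq_zero_iff inner_ge_zero order_antisym)
  then show "A *v xs + B *v ys = b"
    by simp
qed

text \<open>The last step of all three rates: the linear growth of \<open>t\<close> is squared, and
  \<open>(min 1 (2 * bh))\<^sup>2\<close> equals \<open>min 1 (4 * bh\<^sup>2)\<close>.\<close>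

lemma quadratic_rate:
  fixes c bh :: real
  assumes t: "t \<ge> min 1 (2 * bh) * ((real k + 1) / 2)" and bh: "bh > 0"
    and h: "t\<^sup>2 * h \<le> N" and N: "N \<ge> 0"
  shows "h \<le> 4 / min 1 (4 * bh\<^sup>2) * (N / (real k + 1)\<^sup>2)"
proof -
  define c where "c = min 1 (2 * bh) * ((real k + 1) / 2)"
  have c: "c > 0"
    using bh by (simp add: c_def)
  have "(min 1 (2 * bh))\<^sup>2 = min 1 (4 * bh\<^sup>2)"
  proof (cases "2 * bh \<le> 1")
    case True
    then have "(2 * bh)\<^sup>2 \<le> 1\<^sup>2"
      using bh by (intro power_mono) auto
    then show ?thesis
      using True by (simp add: min_def power_mult_distrib)
  next
    case False
    then have "1\<^sup>2 \<le> (2 * bh)\<^sup>2"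
      by (intro power_mono) auto
    then show ?thesis
      using False by (simp add: min_def power_mult_distrib)
  qed
  then have c2: "c\<^sup>2 = min 1 (4 * bh\<^sup>2) * (real k + 1)\<^sup>2 / 4"
    by (simp add: c_def power_mult_distrib power_divide)
  have tc: "t\<^sup>2 \<ge> c\<^sup>2"
    using t c unfolding c_def by (intro power_mono) auto
  then have t2: "t\<^sup>2 > 0"
    using zero_less_power[OF c, of 2] by linarith
  then have "h \<le> N / t\<^sup>2"
    using h by (simp add: pos_le_divide_eq mult.commute)
  also have "\<dots> \<le> N / c\<^sup>2"
    using tc t2 c N by (intro divide_left_mono mult_pos_pos) auto
  also have "\<dots> = 4 / min 1 (4 * bh\<^sup>2) * (N / (real k + 1)\<^sup>2)"
    by (simp add: c2)
  finally show ?thesis .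
qed

subsection \<open>Convergence rates\<close>

theorem mainTheorem9:
  fixes f1 f :: "real^'m \<Rightarrow> ereal" and f2 :: "real^'m \<Rightarrow> real" and df2 :: "real^'m \<Rightarrow> real^'m"
    and g1 g :: "real^'n \<Rightarrow> ereal" and g2 :: "real^'n \<Rightarrow> real" and dg2 :: "real^'n \<Rightarrow> real^'n"
    and A :: "real^'m^'p" and B :: "real^'n^'p" and b :: "real^'p"
    and L :: "real^'m \<Rightarrow> real^'n \<Rightarrow> real^'p \<Rightarrow> ereal"
    and Lf2 Lg2 \<mu>g \<alpha> \<beta> \<gamma> a bhat E1 C1 :: real
    and t :: "nat \<Rightarrow> real"
    and x u :: "nat \<Rightarrow> real^'m" and y v :: "nat \<Rightarrow> real^'n" and l :: "nat \<Rightarrow> real^'p"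
    and xs :: "real^'m" and ys :: "real^'n" and ls :: "real^'p"
  assumes f_def: "f = (\<lambda>x. f1 x + ereal (f2 x))"
    and g_def: "g = (\<lambda>y. g1 y + ereal (g2 y))"
    and f1: "\<forall>x. f1 x \<noteq> - \<infinity>" "proper_fun f1" "closed_fun f1" "convex_fun f1"
    and f2: "convex_on UNIV f2" "\<forall>x. GDERIV f2 x :> df2 x" "Lf2-lipschitz_on UNIV df2"
    and g1: "\<forall>y. g1 y \<noteq> - \<infinity>" "proper_fun g1" "closed_fun g1"
      "\<mu>g > 0" "strongly_convex_fun \<mu>g g1"
    and g2: "convex_on UNIV g2" "\<forall>y. GDERIV g2 y :> dg2 y" "Lg2-lipschitz_on UNIV dg2"
    and L_def: "L = lagrangian f g A B b"
    and saddle_nonempty: "saddle_points L \<noteq> {}"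
    and params: "\<alpha> > 0" "\<beta> > 0" "\<gamma> > 0" "t 1 \<ge> 1"
      "ereal \<alpha> \<le> 1 / ereal Lf2" "ereal \<beta> \<le> ereal ((t 1)\<^sup>2) / ereal Lg2"
    and a_def: "a = \<beta> * \<mu>g / (1 + \<beta> * \<gamma> * (onorm (\<lambda>z. B *v z))\<^sup>2)"
    and bhat_def: "bhat = 2 * a * t 1 / (a + 4 * t 1)"
    and t_rec: "\<forall>k\<ge>1. t (k + 1) =
      min ((1 + sqrt (1 + 4 * (t k)\<^sup>2)) / 2) (sqrt ((t k)\<^sup>2 + a * t k))"
    and alg: "algorithm1 f1 f2 df2 g1 g2 dg2 A B b \<mu>g \<alpha> \<beta> \<gamma> t x y u v l"
    and saddle: "(xs, ys, ls) \<in> saddle_points L"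
    and E1_def: "E1 = (t 1)\<^sup>2 * real_of_ereal (L (x 1) (y 1) ls - L xs ys ls)
      + 1 / (2 * \<alpha>) * (norm (x 1 - xs))\<^sup>2 + (t 2)\<^sup>2 / (2 * \<beta>) * (norm (y 1 - ys))\<^sup>2
      + 1 / (2 * \<gamma>) * (norm (l 1 - ls))\<^sup>2"
    and C1_def: "C1 = 3 * (t 1)\<^sup>2 * norm (A *v x 1 + B *v y 1 - b)
      + (2 * norm (l 1 - ls)
         + 2 * sqrt (2 * \<gamma> * E1 + \<gamma>\<^sup>2 * (t 2)\<^sup>2 * (norm (B *v (y 1 - ys)))\<^sup>2)) / \<gamma>"
  shows "\<forall>k\<ge>1.
      t k \<ge> min 1 (2 * bhat) * ((real k + 1) / 2) \<and>
      L (x k) (y k) ls - L xs ys ls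
        \<le> ereal (4 / min 1 (4 * bhat\<^sup>2) *
            ((E1 + \<gamma> * (t 2)\<^sup>2 / 2 * (norm (B *v (y 1 - ys)))\<^sup>2) / (real k + 1)\<^sup>2)) \<and>
      norm (A *v x k + B *v y k - b)
        \<le> 4 / min 1 (4 * bhat\<^sup>2) * (C1 / (real k + 1)\<^sup>2) \<and>
      \<bar>f (x k) + g (y k) - f xs - g ys\<bar>
        \<le> ereal (4 / min 1 (4 * bhat\<^sup>2) *
            ((E1 + \<gamma> * (t 2)\<^sup>2 / 2 * (norm (B *v (y 1 - ys)))\<^sup>2 + C1 * norm ls) / (real k + 1)\<^sup>2))"
proof -

  \<comment> \<open>Real-valued objectives and the saddle value\<close>
  define F where "F z = real_of_ereal (f1 z) + f2 z" for z
  define G where "G z = real_of_ereal (g1 z) + g2 z" for z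
  define w where "w k = A *v x k + B *v y k - b" for k
  define H where "H k = F (x k) + G (y k) + ls \<bullet> w k - (F xs + G ys)" for k
  define N where "N = onorm (\<lambda>z. B *v z)"
  define En where "En k = (t k)\<^sup>2 * H k + 1 / (2 * \<alpha>) * (norm (u k - xs))\<^sup>2
    + (t (k + 1))\<^sup>2 / (2 * \<beta>) * (norm (v k - ys))\<^sup>2 + 1 / (2 * \<gamma>) * (norm (l k - ls))\<^sup>2
    + \<gamma> * (t (k + 1))\<^sup>2 / 2 * (norm (B *v (v k - ys)))\<^sup>2" for k
  note alg = alg[unfolded algorithm1_def Let_def]
  have init: "x 1 = x 0" "u 1 = x 1" "x 1 \<in> edom f" "y 1 = y 0" "v 1 = y 1" "y 1 \<in> edom g"
    using alg unfolding f_def g_def by blast+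
  have edom_f: "edom f = edom f1" and edom_g: "edom g = edom g1"
    unfolding f_def g_def edom_def by auto
  have ninf: "f z \<noteq> - \<infinity>" "g z' \<noteq> - \<infinity>" for z z'
    using f1(1) g1(1) by (simp_all add: f_def g_def)
  have proper: "proper_fun f" "proper_fun g"
    using f1(2) g1(2) by (simp_all add: proper_fun_def edom_f edom_g)
  have f_eq: "f z = ereal (F z)" if "z \<in> edom f" for z
    using real_of_ereal_eq_finite[of f1 z] f1(1) that
    by (simp add: F_def f_def edom_f[unfolded f_def]) (metis plus_ereal.simps(1))
  have g_eq: "g z = ereal (G z)" if "z \<in> edom g" for z
    using real_of_ereal_eq_finite[of g1 z] g1(1) that
    by (simp add: G_def g_def edom_g[unfolded g_def]) (metis plus_ereal.simps(1))
  note saddle' = saddle[unfolded L_def]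
  note sp = saddle_point_finite_feasible[OF saddle' ninf proper]
  have Ls: "L xs ys ls = ereal (F xs + G ys)"
    using sp(3) by (simp add: L_def lagrangian_def f_eq[OF sp(1)] g_eq[OF sp(2)])

  \<comment> \<open>Properties of the momentum sequence\<close>
  have a: "a > 0"
    using params g1(4) unfolding a_def by (intro divide_pos_pos add_pos_nonneg) auto
  have rec: "t (k + 1) = min ((1 + sqrt (1 + 4 * (t k)\<^sup>2)) / 2) (sqrt ((t k)\<^sup>2 + a * t k))"
    if "k \<ge> 1" for k
    using t_rec that by blast
  have t_ge: "t k \<ge> t 1" if "k \<ge> 1" for k
    using momentum_ge_first[OF a params(4) rec that] .
  then have t_ge_1: "t k \<ge> 1" if "k \<ge> 1" for k
    using params(4) that order_trans by blast
  note t_step = momentum_step_bounds[OF t_ge_1 a rec]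

  \<comment> \<open>Iterates and the Lagrangian gap\<close>
  have x_min: "is_arg_min (x_objective f1 df2 A B b \<alpha> \<gamma> (t (k + 1)) (x k)
      (x k + ((t k - 1) / t (k + 1)) *\<^sub>R (x k - x (k - 1))) (v k) (l k)) (\<lambda>_. True) (x (k + 1))"
    and u_step: "u (k + 1) = x (k + 1) + (t (k + 1) - 1) *\<^sub>R (x (k + 1) - x k)"
    and y_min: "is_arg_min (y_objective g1 dg2 A B b \<mu>g
      (\<beta> / ((t (k + 1))\<^sup>2 + \<beta> * \<mu>g * (t (k + 1) - 1))) \<gamma> (t (k + 1)) (y k)
      (y k + ((t k - 1) / t (k + 1)) *\<^sub>R (y k - y (k - 1))) (u (k + 1)) (l k)) (\<lambda>_. True) (y (k + 1))"
    and v_step: "v (k + 1) = y (k + 1) + (t (k + 1) - 1) *\<^sub>R (y (k + 1) - y k)"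
    and l_step: "l (k + 1) = l k + (\<gamma> * t (k + 1)) *\<^sub>R (A *v u (k + 1) + B *v v (k + 1) - b)"
    if "k \<ge> 1" for k
    using alg that by blast+

  \<comment> \<open>For \<open>k > 1\<close> this is the update at index \<open>k - 1\<close>; for
    \<open>k = 1\<close> the momentum terms vanish because \<open>x 1 = x 0\<close> and
    \<open>y 1 = y 0\<close>.\<close>
  have u_eq: "u k = x k + (t k - 1) *\<^sub>R (x k - x (k - 1))"
    and v_eq: "v k = y k + (t k - 1) *\<^sub>R (y k - y (k - 1))" if "k \<ge> 1" for k
    using init u_step[of "k - 1"] v_step[of "k - 1"] that by (cases "k = 1"; simp)+
  have dom: "x k \<in> edom f1 \<and> y k \<in> edom g1" if "k \<ge> 1" for k
    using that
  proof (induction k rule: dec_induct)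
    case base
    then show ?case using init by (simp add: edom_f edom_g)
  next
    case (step k)
    then show ?case
      using arg_min_in_edom[OF f1(2) x_min[OF step(1), unfolded x_objective_def]]
        arg_min_in_edom[OF g1(2) y_min[OF step(1), unfolded y_objective_def]] by simp
  qed
  have L_eq: "L (x k) (y k) ls = ereal (F (x k) + G (y k) + ls \<bullet> w k)" if "k \<ge> 1" for k
    using dom[OF that] by (simp add: L_def lagrangian_def f_eq g_eq edom_f edom_g w_def)
  have H_eq: "L (x k) (y k) ls - L xs ys ls = ereal (H k)" if "k \<ge> 1" for k
    by (simp add: L_eq[OF that] Ls H_def)
  have H_nonneg: "H k \<ge> 0" if "k \<ge> 1" for k
  proof -
    have "L xs ys ls \<le> L (x k) (y k) ls"
      using saddle unfolding saddle_points_def by blast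
    then show ?thesis
      by (simp add: L_eq[OF that] Ls H_def)
  qed

  \<comment> \<open>The case \<open>Lf2 = 0\<close>, where \<open>1 / ereal Lf2\<close> is infinite,
    is treated apart.\<close>
  have Lf: "Lf2 \<le> 1 / \<alpha>"
  proof (cases "Lf2 = 0")
    case False
    then have "Lf2 > 0"
      using lipschitz_on_nonneg[OF f2(3)] by simp
    then show ?thesis
      using params(1) params(5)[unfolded one_ereal_def ereal_divide] by (simp add: field_simps)
  qed (use params in simp)
  \<comment> \<open>The hypothesis involves \<open>t 1\<close> only; \<open>t 1 \<le> t k\<close>
    carries it to every step.\<close>
  have Lg: "Lg2 \<le> (t k)\<^sup>2 / \<beta>" if "k \<ge> 1" for k
  proof (cases "Lg2 = 0")
    case False
    then have "Lg2 > 0"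
      using lipschitz_on_nonneg[OF g2(3)] by simp
    then have "\<beta> * Lg2 \<le> (t 1)\<^sup>2"
      using params(6) by (simp add: field_simps)
    also have "\<dots> \<le> (t k)\<^sup>2"
      using t_ge[OF that] params(4) by (intro power_mono) auto
    finally show ?thesis
      using params(2) by (simp add: field_simps)
  qed (use params in simp)

  \<comment> \<open>With \<open>s = t (k + 1)\<close>, the points \<open>u (k + 1)\<close> and
    \<open>v (k + 1)\<close> combine new and old iterates with weights \<open>s\<close> and
    \<open>1 - s\<close>. These sum to 1, so the residuals combine in the same way.\<close>
  have residual: "t (k + 1) *\<^sub>R (A *v u (k + 1) + B *v v (k + 1) - b)
      = (t (k + 1))\<^sup>2 *\<^sub>R w (k + 1) - (t (k + 1) * (t (k + 1) - 1)) *\<^sub>R w k" if "k \<ge> 1" for k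
    unfolding u_step[OF that] v_step[OF that] w_def
    by (simp add: matrix_vector_right_distrib matrix_vector_mult_diff_distrib
        matrix_vector_mult_scaleR power2_eq_square algebra_simps)

  \<comment> \<open>Monotonicity of the energy\<close>
  have En_step: "En (k + 1) \<le> En k" if k: "k \<ge> 1" for k
  proof -
    let ?s = "t (k + 1)"
    let ?r = "A *v u (k + 1) + B *v v (k + 1) - b"
    let ?d = "B *v (v (k + 1) - v k)"
    let ?e = "B *v (v (k + 1) - ys)"
    have s: "?s \<ge> 1" and k1: "k + 1 \<ge> 1"
      using t_ge_1[of "k + 1"] by auto
    \<comment> \<open>The displacement from the extrapolated point becomes a multiple of the
      increment of \<open>u\<close>, as \<open>accelerated_step\<close> requires.\<close>
    have xbar: "x (k + 1) - (x k + ((t k - 1) / ?s) *\<^sub>R (x k - x (k - 1)))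
        = (1 / ?s) *\<^sub>R (u (k + 1) - u k)"
    proof -
      have "u (k + 1) - u k = ?s *\<^sub>R (x (k + 1) - x k) - (t k - 1) *\<^sub>R (x k - x (k - 1))"
        unfolding u_step[OF k] u_eq[OF k] by (simp add: algebra_simps)
      then show ?thesis
        using s by (simp add: scaleR_diff_right)
    qed
    have ybar: "y (k + 1) - (y k + ((t k - 1) / ?s) *\<^sub>R (y k - y (k - 1)))
        = (1 / ?s) *\<^sub>R (v (k + 1) - v k)"
    proof -
      have "v (k + 1) - v k = ?s *\<^sub>R (y (k + 1) - y k) - (t k - 1) *\<^sub>R (y k - y (k - 1))"
        unfolding v_step[OF k] v_eq[OF k] by (simp add: algebra_simps)
      then show ?thesis
        using s by (simp add: scaleR_diff_right)
    qed
    have X: "?s\<^sup>2 * (F (x (k + 1)) - F xs) - ?s * (?s - 1) * (F (x k) - F xs)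
      \<le> ?s * ((l k + (\<gamma> * ?s) *\<^sub>R (A *v u (k + 1) + B *v v k - b)) \<bullet> (A *v (xs - u (k + 1))))
        + 1 / (2 * \<alpha>) * ((norm (u k - xs))\<^sup>2 - (norm (u (k + 1) - xs))\<^sup>2)"
      unfolding F_def
      by (rule x_update_ineq[OF f1(4) _ f1(2) f2(1) _ f2(3) s Lf u_step[OF k] xbar x_min[OF k]])
        (use f1(1) f2(2) dom[OF k] sp(1) edom_f in auto)
    have Y: "?s\<^sup>2 * (G (y (k + 1)) - G ys) - ?s * (?s - 1) * (G (y k) - G ys)
      \<le> ?s * ((l k + (\<gamma> * ?s) *\<^sub>R ?r) \<bullet> (B *v (ys - v (k + 1))))
        + ?s\<^sup>2 / (2 * \<beta>) * ((norm (v k - ys))\<^sup>2 - (norm (v (k + 1) - ys))\<^sup>2)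
        - ?s * \<mu>g / 2 * (norm (v (k + 1) - ys))\<^sup>2"
      unfolding G_def
      by (rule y_update_ineq[OF _ _ g1(2) g1(5) g2(1) _ g2(3) s _ params(2) Lg[OF k1] v_step[OF k]
            ybar refl y_min[OF k]])
        (use g1(1,4,5) g2(2) dom[OF k] sp(2) edom_g in \<open>auto simp: strongly_convex_fun_def\<close>)
    \<comment> \<open>The \<open>x\<close> step sees \<open>v k\<close> where the new multiplier has
      \<open>v (k + 1)\<close>, hence the correction by \<open>?d\<close>.\<close>
    have l_pred: "l k + (\<gamma> * ?s) *\<^sub>R (A *v u (k + 1) + B *v v k - b) = l (k + 1) - (\<gamma> * ?s) *\<^sub>R ?d"
      unfolding l_step[OF k] by (simp add: matrix_vector_mult_diff_distrib algebra_simps)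
    \<comment> \<open>The saddle point satisfies the constraint, so \<open>b\<close>
      cancels.\<close>
    have Au: "A *v (xs - u (k + 1)) = ?e - ?r" and Bv: "B *v (ys - v (k + 1)) = - ?e"
      using sp(3) by (auto simp: matrix_vector_mult_diff_distrib algebra_simps)
    have ed: "?e - ?d = B *v (v k - ys)"
      by (simp add: matrix_vector_mult_diff_distrib)
    have H: "?s\<^sup>2 * H (k + 1) - ?s * (?s - 1) * H k
      = (?s\<^sup>2 * (F (x (k + 1)) - F xs) - ?s * (?s - 1) * (F (x k) - F xs))
        + (?s\<^sup>2 * (G (y (k + 1)) - G ys) - ?s * (?s - 1) * (G (y k) - G ys)) + ?s * (ls \<bullet> ?r)"
    proof -
      have "?s * (ls \<bullet> ?r) = ls \<bullet> (?s *\<^sub>R ?r)"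
        by simp
      also have "\<dots> = ?s\<^sup>2 * (ls \<bullet> w (k + 1)) - ?s * (?s - 1) * (ls \<bullet> w k)"
        unfolding residual[OF k] by (simp add: inner_diff_right)
      finally show ?thesis
        by (simp only: H_def) (simp add: algebra_simps)
    qed
    show ?thesis
      unfolding En_def
    proof (rule energy_decrease[where H = "H k" and N = N and a = a and \<mu> = \<mu>g])
      \<comment> \<open>The sum of \<open>X\<close>, \<open>Y\<close> and
        \<open>multiplier_step_ineq\<close>, with the left side split by \<open>H\<close>.\<close>
      show "?s\<^sup>2 * H (k + 1) - ?s * (?s - 1) * H k
        \<le> 1 / (2 * \<alpha>) * ((norm (u k - xs))\<^sup>2 - (norm (u (k + 1) - xs))\<^sup>2)
          + ?s\<^sup>2 / (2 * \<beta>) * ((norm (v k - ys))\<^sup>2 - (norm (v (k + 1) - ys))\<^sup>2)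
          - ?s * \<mu>g / 2 * (norm (v (k + 1) - ys))\<^sup>2
          + 1 / (2 * \<gamma>) * ((norm (l k - ls))\<^sup>2 - (norm (l (k + 1) - ls))\<^sup>2)
          + \<gamma> * ?s\<^sup>2 / 2 * ((norm (B *v (v k - ys)))\<^sup>2 - (norm (B *v (v (k + 1) - ys)))\<^sup>2)"
        using X[unfolded l_pred Au] Y[folded l_step[OF k], unfolded Bv]
          multiplier_step_ineq[OF params(3) l_step[OF k], of ?d ?e ls, unfolded ed]
        unfolding H by simp
      have "norm (B *v (v (k + 1) - ys)) \<le> N * norm (v (k + 1) - ys)"
        unfolding N_def by (rule onorm) (rule matrix_vector_mul_bounded_linear)
      then have "(norm (B *v (v (k + 1) - ys)))\<^sup>2 \<le> (N * norm (v (k + 1) - ys))\<^sup>2"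
        by (intro power_mono) auto
      then show "(norm (B *v (v (k + 1) - ys)))\<^sup>2 \<le> N\<^sup>2 * (norm (v (k + 1) - ys))\<^sup>2"
        by (simp add: power_mult_distrib)
      show "?s * (?s - 1) \<le> (t k)\<^sup>2"
        by (rule t_step(2)[OF k k])
      show "(t (k + 1 + 1))\<^sup>2 \<le> ?s\<^sup>2 + a * ?s"
        by (rule t_step(3)[OF k1 k1])
      show "a = \<beta> * \<mu>g / (1 + \<beta> * \<gamma> * N\<^sup>2)"
        by (simp add: a_def N_def)
    qed (use params s a H_nonneg[OF k] in auto)
  qed

  \<comment> \<open>Consequences of the energy bound\<close>
  have En_le: "En k \<le> En 1" if "k \<ge> 1" for k
    using that
  proof (induction k rule: dec_induct)
    case (step k)
    then show ?case
      using En_step[of k] by simp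
  qed simp
  \<comment> \<open>Since \<open>u 1 = x 1\<close> and \<open>v 1 = y 1\<close>, the initial energy
    is the numerator of the Lagrangian rate.\<close>
  have En1: "En 1 = E1 + \<gamma> * (t 2)\<^sup>2 / 2 * (norm (B *v (y 1 - ys)))\<^sup>2"
    using H_eq[of 1] init by (simp add: En_def E1_def numeral_2_eq_2)
  \<comment> \<open>All summands of \<open>En k\<close> are nonnegative, so each alone is at most
    \<open>En 1\<close>.\<close>
  have H_le: "(t k)\<^sup>2 * H k \<le> En 1" and l_le: "norm (l k - ls) \<le> sqrt (2 * \<gamma> * En 1)"
    if "k \<ge> 1" for k
  proof -
    have nonneg: "0 \<le> (t k)\<^sup>2 * H k" "0 \<le> 1 / (2 * \<alpha>) * (norm (u k - xs))\<^sup>2"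
      "0 \<le> (t (k + 1))\<^sup>2 / (2 * \<beta>) * (norm (v k - ys))\<^sup>2"
      "0 \<le> 1 / (2 * \<gamma>) * (norm (l k - ls))\<^sup>2"
      "0 \<le> \<gamma> * (t (k + 1))\<^sup>2 / 2 * (norm (B *v (v k - ys)))\<^sup>2"
      using H_nonneg[OF that] params(1-3) by simp_all
    then show "(t k)\<^sup>2 * H k \<le> En 1"
      using En_le[OF that] unfolding En_def[of k] by linarith
    have "1 / (2 * \<gamma>) * (norm (l k - ls))\<^sup>2 \<le> En 1"
      using nonneg En_le[OF that] unfolding En_def[of k] by linarith
    then have "(norm (l k - ls))\<^sup>2 \<le> 2 * \<gamma> * En 1"
      using params(3) by (simp add: field_simps)
    then show "norm (l k - ls) \<le> sqrt (2 * \<gamma> * En 1)"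
      by (rule real_le_rsqrt)
  qed
  have "0 \<le> (t 1)\<^sup>2 * H 1"
    using H_nonneg[of 1] by simp
  then have En1_nonneg: "En 1 \<ge> 0"
    using H_le[of 1] by simp

  \<comment> \<open>Decay of the constraint residual\<close>
  define D where "D = (norm (l 1 - ls) + sqrt (2 * \<gamma> * En 1)) / \<gamma>"
  have D: "D \<ge> 0"
    using En1_nonneg params(3) by (simp add: D_def)
  have "2 * \<gamma> * En 1 = 2 * \<gamma> * E1 + \<gamma>\<^sup>2 * (t 2)\<^sup>2 * (norm (B *v (y 1 - ys)))\<^sup>2"
    unfolding En1 by (simp add: power2_eq_square algebra_simps)
  then have C1: "C1 = 3 * (t 1)\<^sup>2 * norm (w 1) + 2 * D"
    by (simp add: C1_def D_def w_def add_divide_distrib)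
  then have C1_nonneg: "C1 \<ge> 0"
    using D by simp
  \<comment> \<open>By \<open>residual\<close>, each multiplier increment is \<open>\<gamma>\<close>
    times one summand, so a bound on the multipliers bounds the sum.\<close>
  have telescope: "\<gamma> *\<^sub>R (\<Sum>j=1..k. (t (j + 1))\<^sup>2 *\<^sub>R w (j + 1) - (t (j + 1) * (t (j + 1) - 1)) *\<^sub>R w j)
      = l (k + 1) - l 1" if "k \<ge> 1" for k
    using that
  proof (induction k rule: dec_induct)
    case base
    show ?case
      using l_step[of 1] residual[of 1] by (simp flip: scaleR_scaleR)
  next
    case (step k)
    have "\<gamma> *\<^sub>R ((t (Suc k + 1))\<^sup>2 *\<^sub>R w (Suc k + 1) - (t (Suc k + 1) * (t (Suc k + 1) - 1)) *\<^sub>R w (Suc k))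
        = l (Suc k + 1) - l (Suc k)"
      using l_step[of "Suc k"] residual[of "Suc k"] by (simp flip: scaleR_scaleR)
    with step.IH show ?case
      by (simp add: scaleR_add_right)
  qed
  have "(t k)\<^sup>2 * norm (w k) \<le> 2 * ((t 1)\<^sup>2 * norm (w 1) + D)" if "k \<ge> 1" for k
  proof (rule weighted_telescoping_bound[where t = t and w = w])
    fix j :: nat
    assume j: "j \<ge> 1"
    let ?S = "\<Sum>j=1..j. (t (j + 1))\<^sup>2 *\<^sub>R w (j + 1) - (t (j + 1) * (t (j + 1) - 1)) *\<^sub>R w j"
    have "\<gamma> * norm ?S = norm ((l (j + 1) - ls) - (l 1 - ls))"
      using arg_cong[OF telescope[OF j], of norm] params(3) by simp
    also have "\<dots> \<le> sqrt (2 * \<gamma> * En 1) + norm (l 1 - ls)"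
      using l_le[of "j + 1"] norm_triangle_ineq4[of "l (j + 1) - ls" "l 1 - ls"] by simp
    finally show "norm ?S \<le> D"
      using params(3) by (simp add: D_def field_simps)
  qed (use t_ge_1 t_step(1,2) D that in auto)
  \<comment> \<open>The factor 2 on the first residual is dominated by the 3 in \<open>C1\<close>;
    the terms in \<open>D\<close> agree.\<close>
  moreover have "2 * ((t 1)\<^sup>2 * norm (w 1) + D) \<le> C1"
    using C1 by simp
  ultimately have w_le: "(t k)\<^sup>2 * norm (w k) \<le> C1" if "k \<ge> 1" for k
    using that order_trans by blast

  \<comment> \<open>The three rates\<close>
  have bh: "bhat > 0"
    using a params(4) unfolding bhat_def by (intro divide_pos_pos) auto
  show ?thesis
  proof (intro allI impI)
    fix k :: nat
    assume k: "k \<ge> 1"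
    have growth: "t k \<ge> min 1 (2 * bhat) * ((real k + 1) / 2)"
      unfolding bhat_def by (rule momentum_linear_growth[OF a params(4) rec k])
    note rate = quadratic_rate[OF growth bh]
    have H: "H k \<le> 4 / min 1 (4 * bhat\<^sup>2) * (En 1 / (real k + 1)\<^sup>2)"
      by (rule rate[OF H_le[OF k] En1_nonneg])
    have W: "norm (w k) \<le> 4 / min 1 (4 * bhat\<^sup>2) * (C1 / (real k + 1)\<^sup>2)"
      by (rule rate[OF w_le[OF k] C1_nonneg])
    have "\<bar>ls \<bullet> w k\<bar> \<le> norm ls * norm (w k)"
      by (rule Cauchy_Schwarz_ineq2)
    then have dev: "\<bar>F (x k) + G (y k) - F xs - G ys\<bar> \<le> H k + norm ls * norm (w k)"
      using H_nonneg[OF k] by (simp add: H_def)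
    \<comment> \<open>The whole sum goes through \<open>quadratic_rate\<close> at once, which places
      \<open>En 1 + C1 * norm ls\<close> in one numerator.\<close>
    have "(t k)\<^sup>2 * (H k + norm ls * norm (w k)) \<le> En 1 + C1 * norm ls"
      using H_le[OF k] mult_right_mono[OF w_le[OF k], of "norm ls"]
      by (simp add: algebra_simps)
    from rate[OF this] have
      "H k + norm ls * norm (w k) \<le> 4 / min 1 (4 * bhat\<^sup>2) * ((En 1 + C1 * norm ls) / (real k + 1)\<^sup>2)"
      using En1_nonneg C1_nonneg by simp
    moreover have "\<bar>f (x k) + g (y k) - f xs - g ys\<bar> = ereal \<bar>F (x k) + G (y k) - F xs - G ys\<bar>"
      using dom[OF k] sp(1,2) by (simp add: f_eq g_eq edom_f edom_g)
    ultimately show "t k \<ge> min 1 (2 * bhat) * ((real k + 1) / 2) \<and>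
      L (x k) (y k) ls - L xs ys ls
        \<le> ereal (4 / min 1 (4 * bhat\<^sup>2) *
            ((E1 + \<gamma> * (t 2)\<^sup>2 / 2 * (norm (B *v (y 1 - ys)))\<^sup>2) / (real k + 1)\<^sup>2)) \<and>
      norm (A *v x k + B *v y k - b)
        \<le> 4 / min 1 (4 * bhat\<^sup>2) * (C1 / (real k + 1)\<^sup>2) \<and>
      \<bar>f (x k) + g (y k) - f xs - g ys\<bar>
        \<le> ereal (4 / min 1 (4 * bhat\<^sup>2) *
            ((E1 + \<gamma> * (t 2)\<^sup>2 / 2 * (norm (B *v (y 1 - ys)))\<^sup>2 + C1 * norm ls) / (real k + 1)\<^sup>2))"
      using growth H W dev unfolding H_eq[OF k] En1 w_def by simp
  qed
qed

end
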